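(* Let $G\simeq[k,\infty,m]$ be a crystallographic string Coxeter group of rank $4$ (so $k,m\in\{2,3,4,6,\infty\}$). Then for every prime $p\ge3$ the reduction $G^p$ of $G$ modulo $p$ is a (string) C-group.
   Context: Setting. $G=\langle r_0,\dots,r_{n-1}\rangle=[p_1,\dots,p_{n-1}]$ denotes a crystallographic Coxeter group with string Coxeter diagram (nodes $0,\dots,n-1$; the branch joining nodes $i-1$ and $i$ is marked $p_i$; $p_i=2$ means no branch), so each $p_i\in\{2,3,4,6,\infty\}$, in its standard representation as a reflection group on real $n$-space $V$. A basic system is a basis $b_0,\dots,b_{n-1}$ of $V$ of suitably rescaled simple roots: $b_i\cdot b_i>0$, $b_{i-1}\cdot b_i=-\cos(\pi/p_i)\sqrt{(b_{i-1}\cdot b_{i-1})(b_i\cdot b_i)}$ (with $\cos(\pi/\infty)=1$), $b_i\cdot b_j=0$ for $|i-j|\ge2$, $r_i(x)=x-2\frac{x\cdot b_i}{b_i\cdot b_i}b_i$, and all numbers $2\frac{b_i\cdot b_j}{b_i\cdot b_i}$ are integers. Reduction. For an odd prime $p$, the integer matrices of the $r_i$ in the basis $(b_i)$ are reduced modulo $p$; $G^p$ is the subgroup of $GL_n(\mathbb Z_p)$ (where $\mathbb Z_p=\mathbb Z/p\mathbb Z$) generated by these reductions, again denoted $r_0,\dots,r_{n-1}$. In some cases with $p=3$ and some $p_i=6$, $G^p$ may depend on the basic system; the statement refers to any choice of basic system. $G^p$ is a (string) C-group if $\langle r_i\mid i\in I\rangle\cap\langle r_i\mid i\in J\rangle=\langle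 r_i\mid i\in I\cap J\rangle$ in $G^p$ for all $I,J\subseteq\{0,\dots,n-1\}$. *)

theory Defs
  imports
    "Jordan_Normal_Form.Matrix"
    "HOL-Algebra.Generated_Groups"
    "HOL-Library.Extended_Nat"
    "HOL-Computational_Algebra.Primes"
begin

text \<open>A string Coxeter diagram of rank \<open>n\<close> is given by the list \<open>[p\<^sub>1, \<dots>, p\<^bsub>n-1\<^esub>]\<close> of its marks;
  the mark of the branch joining nodes \<open>i\<close> and \<open>i + 1\<close> is the list entry \<open>ps ! i\<close>, and the mark
  2 stands for a missing branch.\<close>

definition crystallographic_marks :: "enat list \<Rightarrow> bool" where
  "crystallographic_marks ps \<longleftrightarrow> set ps \<subseteq> {2, 3, 4, 6, \<infinity>}"

fun cos_mark :: "enat \<Rightarrow> real" where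
  "cos_mark (enat m) = cos (pi / real m)"
| "cos_mark \<infinity> = 1"

text \<open>The conditions below determine the form \<open>B\<close> on \<open>V\<close> (the type \<open>'v\<close>) from the diagram and
  the numbers \<open>B (b i) (b i)\<close>, so that \<open>V\<close> with the reflections in the \<open>b i\<close> is the standard
  representation, with simple roots rescaled by positive factors.  The form may be degenerate
  or indefinite.\<close>

definition basic_system ::
  "enat list \<Rightarrow> ('v::real_vector \<Rightarrow> 'v \<Rightarrow> real) \<Rightarrow> (nat \<Rightarrow> 'v) \<Rightarrow> bool" where
  "basic_system ps B b \<longleftrightarrow>
    (let n = length ps + 1 in
      (\<forall>x. linear (B x)) \<and> (\<forall>x y. B x y = B y x) \<and>
      inj_on b {..<n} \<and> independent (b ` {..<n}) \<and> span (b ` {..<n}) = UNIV \<and>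
      (\<forall>i<n. B (b i) (b i) > 0) \<and>
      (\<forall>i. i + 1 < n \<longrightarrow>
        B (b i) (b (i + 1)) =
          - cos_mark (ps ! i) * sqrt (B (b i) (b i) * B (b (i + 1)) (b (i + 1)))) \<and>
      (\<forall>i<n. \<forall>j<n. i + 2 \<le> j \<longrightarrow> B (b i) (b j) = 0) \<and>
      (\<forall>i<n. \<forall>j<n. 2 * B (b i) (b j) / B (b i) (b i) \<in> \<int>))"

definition refl_in :: "('v::real_vector \<Rightarrow> 'v \<Rightarrow> real) \<Rightarrow> 'v \<Rightarrow> 'v \<Rightarrow> 'v" where
  "refl_in B a x = x - (2 * B x a / B a a) *\<^sub>R a"

definition matrix_in_basis ::
  "nat \<Rightarrow> (nat \<Rightarrow> 'v::real_vector) \<Rightarrow> ('v \<Rightarrow> 'v) \<Rightarrow> real mat" where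
  "matrix_in_basis n b f =
    mat n n (\<lambda>(i, j). representation (b ` {..<n}) (f (b j)) (b i))"

text \<open>Residues modulo \<open>p\<close> are represented by \<open>{0..<p}\<close>, as in the library's \<open>residue_ring\<close>.\<close>

definition reduce_mat :: "nat \<Rightarrow> int mat \<Rightarrow> int mat" where
  "reduce_mat p A = map_mat (\<lambda>x. x mod int p) A"

definition residue_mat_monoid :: "nat \<Rightarrow> nat \<Rightarrow> int mat monoid" where
  "residue_mat_monoid n p =
    \<lparr>carrier = {A \<in> carrier_mat n n. elements_mat A \<subseteq> {0..<int p}},
     mult = (\<lambda>A B. reduce_mat p (A * B)),
     one = 1\<^sub>m n\<rparr>"

definition GL_mod :: "nat \<Rightarrow> nat \<Rightarrow> int mat monoid" where
  "GL_mod n p = units_of (residue_mat_monoid n p)"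

text \<open>For a basic system the matrices of the reflections have integer entries, so \<open>floor\<close> only
  changes the type from \<open>real\<close> to \<open>int\<close>.\<close>

definition reduced_reflection ::
  "nat \<Rightarrow> nat \<Rightarrow> ('v::real_vector \<Rightarrow> 'v \<Rightarrow> real) \<Rightarrow> (nat \<Rightarrow> 'v) \<Rightarrow> nat \<Rightarrow> int mat" where
  "reduced_reflection n p B b i =
    reduce_mat p (map_mat floor (matrix_in_basis n b (refl_in B (b i))))"

definition reduced_group ::
  "nat \<Rightarrow> nat \<Rightarrow> ('v::real_vector \<Rightarrow> 'v \<Rightarrow> real) \<Rightarrow> (nat \<Rightarrow> 'v) \<Rightarrow> int mat monoid" where
  "reduced_group n p B b =
    (GL_mod n p)\<lparr>carrier := generate (GL_mod n p) (reduced_reflection n p B b ` {..<n})\<rparr>"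

definition is_C_group :: "('a, 'c) monoid_scheme \<Rightarrow> nat \<Rightarrow> (nat \<Rightarrow> 'a) \<Rightarrow> bool" where
  "is_C_group G n r \<longleftrightarrow>
    (\<forall>I J. I \<subseteq> {..<n} \<longrightarrow> J \<subseteq> {..<n} \<longrightarrow>
      generate G (r ` I) \<inter> generate G (r ` J) = generate G (r ` (I \<inter> J)))"

end

theory Submission
  imports Defs "HOL-Number_Theory.Cong"
begin

text \<open>Put \<open>N i j = 2 (b\<^sub>i \<sqdot> b\<^sub>j) / (b\<^sub>i \<sqdot> b\<^sub>i)\<close>, so that
  \<open>r\<^sub>i b\<^sub>j = b\<^sub>j - N i j b\<^sub>i\<close>.  Left multiplication by \<open>r\<^sub>i\<close> changes only row \<open>i\<close>
  of a matrix, so the elements of \<open>G\<^sub>I = \<langle>r\<^sub>i | i \<in> I\<rangle>\<close> have rows of the identity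
  matrix outside \<open>I\<close>, and those of \<open>G\<^sub>I \<inter> G\<^sub>J\<close> have them outside \<open>I \<inter> J\<close>.  The
  content of the theorem is that such an element, known to lie in \<open>G\<^sub>I\<close> and in \<open>G\<^sub>J\<close>,
  lies in \<open>G\<^bsub>I \<inter> J\<^esub>\<close>.

  If no node of \<open>I \<inter> J\<close> is adjacent to a node of \<open>I - J\<close>, then the rows in \<open>I \<inter> J\<close> are
  not influenced by the generators from \<open>I - J\<close>, and these can be dropped
  (\<open>gen_inter_nonadjacent\<close>).  Splitting off commuting factors as well (\<open>gen_split\<close>), all pairs
  \<open>I, J\<close> reduce, up to reversal of the diagram, to two intersections:
  \<open>\<langle>r\<^sub>0, r\<^sub>1\<rangle> \<inter> \<langle>r\<^sub>1, r\<^sub>2, r\<^sub>3\<rangle>\<close> (\<open>inter_01_123\<close>) and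
  \<open>\<langle>r\<^sub>0, r\<^sub>1, r\<^sub>2\<rangle> \<inter> \<langle>r\<^sub>1, r\<^sub>2, r\<^sub>3\<rangle>\<close> (\<open>inter_012_123\<close>).

  Here the infinite branch is used.  As \<open>N 1 2 * N 2 1 = 4\<close> is a unit modulo the odd prime \<open>p\<close>,
  there is a symmetric form modulo \<open>p\<close> that is invariant under \<open>r\<^sub>1\<close> and \<open>r\<^sub>2\<close> and for which
  \<open>b\<^sub>1\<close> and \<open>b\<^sub>2\<close> are anisotropic.  The generator \<open>r\<^sub>3\<close> need not preserve it (the trouble is
  \<open>p dvd N 3 2\<close>, which a mark 6 can cause for \<open>p = 3\<close>), but on the span of \<open>b\<^sub>0, b\<^sub>1, b\<^sub>2\<close> every
  element of \<open>\<langle>r\<^sub>1, r\<^sub>2, r\<^sub>3\<rangle>\<close> preserves the form: when \<open>r\<^sub>3\<close> does not, it acts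
  trivially on this span (\<open>form_columns\<close>).  An element of the first intersection moves every
  vector by a multiple of \<open>b\<^sub>1\<close>, and invariance of the form leaves only \<open>1\<close> and \<open>r\<^sub>1\<close>.
  For the second intersection, the form on the span of \<open>b\<^sub>1, b\<^sub>2\<close> has rank one, and the dihedral
  group \<open>\<langle>r\<^sub>1, r\<^sub>2\<rangle>\<close> is transitive modulo \<open>p\<close> on the vectors of the span that have
  the norm of \<open>b\<^sub>1\<close>: a sign and a translation along the radical suffice (\<open>normalize_column\<close>).
  So an element \<open>g\<close> of the intersection may be assumed to fix \<open>b\<^sub>1\<close>.  If \<open>N 1 0\<close> and \<open>N 2 3\<close> are
  units, \<open>b\<^sub>0\<close> and \<open>b\<^sub>3\<close> pair nontrivially with the radical, and invariance of the form under
  \<open>\<langle>r\<^sub>1, r\<^sub>2, r\<^sub>3\<rangle>\<close> and, by reversal, under \<open>\<langle>r\<^sub>0, r\<^sub>1, r\<^sub>2\<rangle>\<close> forces \<open>g = 1\<close>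
  (\<open>columns_trivial\<close>).  If one of them vanishes, the outer generator does not influence the rows
  1 and 2 and can be dropped.\<close>

section \<open>Groups generated by reflections modulo a number\<close>

text \<open>The entries \<open>ent g i j\<close> matter only modulo \<open>p\<close>.  Keeping \<open>ent\<close> a parameter, instead of working
  with matrices directly, makes the reversal of the diagram an instance of the same locale.\<close>

locale mod_reflection_group = group G for G (structure) +
  fixes n :: nat and p :: int and N :: "nat \<Rightarrow> nat \<Rightarrow> int"
    and r :: "nat \<Rightarrow> 'a" and ent :: "'a \<Rightarrow> nat \<Rightarrow> nat \<Rightarrow> int"
  assumes r_closed: "i < n \<Longrightarrow> r i \<in> carrier G"
    and r_involution: "i < n \<Longrightarrow> r i \<otimes> r i = \<one>"
    and ent_one: "i < n \<Longrightarrow> j < n \<Longrightarrow> [ent \<one> i j = of_bool (i = j)] (mod p)"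
    and ent_same: "i < n \<Longrightarrow> j < n \<Longrightarrow> g \<in> carrier G \<Longrightarrow>
      [ent (r i \<otimes> g) i j = ent g i j - (\<Sum>k<n. N i k * ent g k j)] (mod p)"
    and ent_other: "i < n \<Longrightarrow> l < n \<Longrightarrow> j < n \<Longrightarrow> l \<noteq> i \<Longrightarrow> g \<in> carrier G \<Longrightarrow>
      [ent (r i \<otimes> g) l j = ent g l j] (mod p)"
    and ent_faithful: "g \<in> carrier G \<Longrightarrow> h \<in> carrier G \<Longrightarrow>
      (\<And>i j. i < n \<Longrightarrow> j < n \<Longrightarrow> [ent g i j = ent h i j] (mod p)) \<Longrightarrow> g = h"
begin

definition gen :: "nat set \<Rightarrow> 'a set" where
  "gen I = generate G (r ` I)"

definition trivial_row :: "'a \<Rightarrow> nat \<Rightarrow> bool" where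
  "trivial_row g i \<longleftrightarrow> (\<forall>j<n. [ent g i j = of_bool (i = j)] (mod p))"

lemma trivial_rowD: "trivial_row g i \<Longrightarrow> j < n \<Longrightarrow> [ent g i j = of_bool (i = j)] (mod p)"
  by (simp add: trivial_row_def)

lemma gen_closed: "I \<subseteq> {..<n} \<Longrightarrow> g \<in> gen I \<Longrightarrow> g \<in> carrier G"
  unfolding gen_def using generate_in_carrier[of "r ` I"] r_closed by blast

lemma gen_subgroup: "I \<subseteq> {..<n} \<Longrightarrow> subgroup (gen I) G"
  unfolding gen_def using generate_is_subgroup[of "r ` I"] r_closed by blast

lemma gen_mono: "I \<subseteq> J \<Longrightarrow> gen I \<subseteq> gen J"
  unfolding gen_def by (simp add: image_mono mono_generate)

lemma one_in_gen: "\<one> \<in> gen I"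
  unfolding gen_def by (rule generate.one)

lemma r_in_gen: "i \<in> I \<Longrightarrow> r i \<in> gen I"
  unfolding gen_def by (simp add: generate.incl)

lemma gen_mult: "g \<in> gen I \<Longrightarrow> h \<in> gen I \<Longrightarrow> g \<otimes> h \<in> gen I"
  unfolding gen_def by (rule generate.eng)

lemma gen_inv: "I \<subseteq> {..<n} \<Longrightarrow> g \<in> gen I \<Longrightarrow> inv g \<in> gen I"
  by (rule subgroup.m_inv_closed[OF gen_subgroup])

lemma r_cancel: "i < n \<Longrightarrow> g \<in> carrier G \<Longrightarrow> r i \<otimes> (r i \<otimes> g) = g"
  by (metis l_one m_assoc r_closed r_involution)

text \<open>The generators are involutions, so every element is a product of generators and can be built
  up by left multiplications, the operations whose effect on the rows is known.\<close>

lemma gen_induct [consumes 2, case_names one refl]: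
  assumes "I \<subseteq> {..<n}" and "g \<in> gen I"
    and "P \<one>"
    and step: "\<And>i x. i \<in> I \<Longrightarrow> x \<in> gen I \<Longrightarrow> P x \<Longrightarrow> P (r i \<otimes> x)"
  shows "P g"
proof -
  have "\<forall>x\<in>gen I. P x \<longrightarrow> P (g \<otimes> x)"
    using \<open>g \<in> gen I\<close> unfolding gen_def
  proof (induction rule: generate.induct)
    case one
    then show ?case using gen_closed assms(1) unfolding gen_def by auto
  next
    case (incl h)
    then show ?case using step unfolding gen_def by auto
  next
    case (inv h)
    then obtain i where i: "i \<in> I" "h = r i" by auto
    then have "inv h = h"
      using assms(1) r_involution r_closed inv_equality by (metis lessThan_iff subsetD)
    then show ?case using i step unfolding gen_def by auto
  next
    case (eng h1 h2)
    have c: "h1 \<in> carrier G" "h2 \<in> carrier G"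
      using eng.hyps gen_closed[OF assms(1)] unfolding gen_def by auto
    show ?case
    proof (intro ballI impI)
      fix x assume x: "x \<in> generate G (r ` I)" "P x"
      then have "x \<in> carrier G" using gen_closed[OF assms(1)] unfolding gen_def by auto
      moreover have "P (h1 \<otimes> (h2 \<otimes> x))"
        using eng x generate.eng by metis
      ultimately show "P (h1 \<otimes> h2 \<otimes> x)" using c by (simp add: m_assoc)
    qed
  qed
  moreover have "g \<in> carrier G" using assms gen_closed by blast
  ultimately show ?thesis using assms(3) one_in_gen by fastforce
qed

text \<open>Row \<open>i\<close> of \<open>r i \<otimes> g\<close> depends only on the rows of \<open>g\<close> at \<open>i\<close> and at the nodes adjacent to
  \<open>i\<close>; so knowledge of these rows suffices to compute it.\<close>

lemma row_sum_cong:
  assumes "\<And>k. k < n \<Longrightarrow> [N i k = 0] (mod p) \<or> [v k = w k] (mod p)"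
  shows "[(\<Sum>k<n. N i k * v k) = (\<Sum>k<n. N i k * w k)] (mod p)"
proof (rule cong_sum)
  fix k assume "k \<in> {..<n}"
  then consider "[N i k = 0] (mod p)" | "[v k = w k] (mod p)" using assms by auto
  then show "[N i k * v k = N i k * w k] (mod p)"
  proof cases
    case 1
    then have "p dvd N i k * v k" "p dvd N i k * w k" by (auto simp: cong_0_iff)
    then show ?thesis by (simp add: cong_iff_dvd_diff)
  qed (simp add: cong_scalar_left)
qed

lemma ent_same_cong:
  assumes "i < n" "j < n" "g \<in> carrier G" "[ent g i j = v i] (mod p)"
    and "\<And>k. k < n \<Longrightarrow> [N i k = 0] (mod p) \<or> [ent g k j = v k] (mod p)"
  shows "[ent (r i \<otimes> g) i j = v i - (\<Sum>k<n. N i k * v k)] (mod p)"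
  using cong_trans[OF ent_same[OF assms(1-3)] cong_diff[OF assms(4) row_sum_cong[OF assms(5)]]]
  by blast

lemma trivial_row_outside:
  assumes "I \<subseteq> {..<n}" "g \<in> gen I" "l < n" "l \<notin> I"
  shows "trivial_row g l"
  using assms(1,2)
proof (induction rule: gen_induct)
  case one
  then show ?case using assms ent_one by (simp add: trivial_row_def)
next
  case (refl i x)
  then have "i < n" "l \<noteq> i" "x \<in> carrier G" using assms gen_closed by auto
  then show ?case
    using refl ent_other[OF _ assms(3)] unfolding trivial_row_def by (blast intro: cong_trans)
qed

lemma trivial_column:
  assumes "I \<subseteq> {..<n}" "g \<in> gen I" "j < n" "j \<notin> I"
    and "\<And>i. i \<in> I \<Longrightarrow> [N i j = 0] (mod p)" and "l < n"
  shows "[ent g l j = of_bool (l = j)] (mod p)"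
proof -
  have "\<forall>l<n. [ent g l j = of_bool (l = j)] (mod p)"
    using assms(1,2)
  proof (induction rule: gen_induct)
    case one
    then show ?case using assms ent_one by simp
  next
    case (refl i x)
    then have i: "i < n" "i \<noteq> j" "x \<in> carrier G" "[N i j = 0] (mod p)"
      using assms gen_closed by auto
    have "[ent (r i \<otimes> x) i j = of_bool (i = j) - (\<Sum>k<n. N i k * of_bool (k = j))] (mod p)"
      by (rule ent_same_cong) (use refl i assms in auto)
    also have "(\<Sum>k<n. N i k * of_bool (k = j)) = N i j"
      using assms(3) by (simp add: of_bool_def if_distrib cong: if_cong)
    also have "[of_bool (i = j) - N i j = of_bool (i = j) - 0] (mod p)"
      by (rule cong_diff) (use i in auto)
    finally have "[ent (r i \<otimes> x) i j = of_bool (i = j)] (mod p)" by simp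
    then show ?case
      using refl.IH ent_other[OF i(1) _ assms(3) _ i(3)] by (metis cong_trans)
  qed
  then show ?thesis using assms by blast
qed

lemma trivial_imp_one:
  assumes "g \<in> carrier G" "\<And>i. i < n \<Longrightarrow> trivial_row g i"
  shows "g = \<one>"
proof (rule ent_faithful)
  fix i j assume "i < n" "j < n"
  then have "[ent g i j = of_bool (i = j)] (mod p)" "[ent \<one> i j = of_bool (i = j)] (mod p)"
    using assms(2) ent_one unfolding trivial_row_def by auto
  then show "[ent g i j = ent \<one> i j] (mod p)" by (metis cong_trans cong_sym)
qed (use assms in auto)

text \<open>If no row in \<open>K\<close> is influenced by a row in \<open>L\<close>, then deleting from a word all letters that
  belong to \<open>L\<close> does not change the rows outside \<open>L\<close>.\<close>

lemma agree_off_rows: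
  assumes "K \<union> L \<subseteq> {..<n}" "g \<in> gen (K \<union> L)"
    and "\<And>i j. i \<in> K \<Longrightarrow> j \<in> L \<Longrightarrow> [N i j = 0] (mod p)"
  shows "\<exists>h\<in>gen K. \<forall>i<n. i \<notin> L \<longrightarrow> (\<forall>j<n. [ent g i j = ent h i j] (mod p))"
  using assms(1,2)
proof (induction rule: gen_induct)
  case one
  then show ?case by (intro bexI[of _ \<one>]) (auto simp: one_in_gen)
next
  case (refl i x)
  then obtain h where h: "h \<in> gen K"
    "\<And>l j. l < n \<Longrightarrow> l \<notin> L \<Longrightarrow> j < n \<Longrightarrow> [ent x l j = ent h l j] (mod p)" by blast
  have i: "i < n" "x \<in> carrier G" "h \<in> carrier G"
    using refl h assms(1) gen_closed[of K] gen_closed[OF assms(1)] by auto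
  show ?case
  proof (cases "i \<in> L")
    case True
    then show ?thesis using h ent_other[OF i(1) _ _ _ i(2)] by (metis cong_trans)
  next
    case False
    then have iK: "i \<in> K" using refl by auto
    have "[ent (r i \<otimes> x) l j = ent (r i \<otimes> h) l j] (mod p)" if "l < n" "l \<notin> L" "j < n" for l j
    proof (cases "l = i")
      case True
      have "[ent (r i \<otimes> x) i j = ent h i j - (\<Sum>k<n. N i k * ent h k j)] (mod p)"
        by (rule ent_same_cong) (use i that True h assms(3)[OF iK] in auto)
      then show ?thesis
        using True ent_same[OF i(1) that(3) i(3)] by (metis cong_trans cong_sym)
    next
      case False
      then show ?thesis
        using h(2)[OF that] ent_other[OF i(1) that(1,3) False] i by (metis cong_trans cong_sym)
    qed
    moreover have "r i \<otimes> h \<in> gen K" using iK h gen_mult r_in_gen by blast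
    ultimately show ?thesis by blast
  qed
qed

lemma gen_if_trivial_rows:
  assumes "K \<union> L \<subseteq> {..<n}" "g \<in> gen (K \<union> L)" "K \<inter> L = {}"
    and "\<And>i j. i \<in> K \<Longrightarrow> j \<in> L \<Longrightarrow> [N i j = 0] (mod p)"
    and "\<And>i. i \<in> L \<Longrightarrow> trivial_row g i"
  shows "g \<in> gen K"
proof -
  obtain h where h: "h \<in> gen K"
    "\<And>l j. l < n \<Longrightarrow> l \<notin> L \<Longrightarrow> j < n \<Longrightarrow> [ent g l j = ent h l j] (mod p)"
    using agree_off_rows[OF assms(1,2,4)] by blast
  have "[ent g l j = ent h l j] (mod p)" if "l < n" "j < n" for l j
  proof (cases "l \<in> L")
    case True
    then have "trivial_row h l" "trivial_row g l"
      using assms trivial_row_outside[of K h l] h that by auto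
    then show ?thesis using that unfolding trivial_row_def by (metis cong_trans cong_sym)
  qed (use h that in auto)
  then have "g = h"
    using ent_faithful gen_closed h assms by (metis Un_subset_iff)
  then show ?thesis using h by simp
qed

text \<open>This is the dual deletion principle.  The hypothesis says that the generators in \<open>L\<close> fix all
  basis vectors outside \<open>L\<close>, and the span of these vectors is invariant under the generators in
  \<open>K\<close>; so letters from \<open>L\<close> can be deleted without changing the action on this span.\<close>

lemma agree_off_columns:
  assumes "K \<union> L \<subseteq> {..<n}" "g \<in> gen (K \<union> L)" "K \<inter> L = {}"
    and "\<And>l i. l \<in> L \<Longrightarrow> i < n \<Longrightarrow> i \<notin> L \<Longrightarrow> [N l i = 0] (mod p)"
  shows "\<exists>h\<in>gen K. \<forall>j<n. j \<notin> L \<longrightarrow> (\<forall>i<n. [ent g i j = ent h i j] (mod p))"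
  using assms(1,2)
proof (induction rule: gen_induct)
  case one
  then show ?case by (intro bexI[of _ \<one>]) (auto simp: one_in_gen)
next
  case (refl i x)
  then obtain h where h: "h \<in> gen K"
    "\<And>l j. l < n \<Longrightarrow> j \<notin> L \<Longrightarrow> j < n \<Longrightarrow> [ent x l j = ent h l j] (mod p)" by blast
  have i: "i < n" "x \<in> carrier G" "h \<in> carrier G"
    using refl h assms(1) gen_closed[of K] gen_closed[OF assms(1)] by auto
  have same: "[ent (r i \<otimes> x) i j = ent h i j - (\<Sum>k<n. N i k * ent h k j)] (mod p)"
    if "j < n" "j \<notin> L" for j
    by (rule ent_same_cong) (use i that h in auto)
  show ?case
  proof (cases "i \<in> L")
    case True
    have "[ent (r i \<otimes> x) l j = ent h l j] (mod p)" if "l < n" "j \<notin> L" "j < n" for l j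
    proof (cases "l = i")
      case l: True
      have "[(\<Sum>k<n. N i k * ent h k j) = (\<Sum>k<n. N i k * 0)] (mod p)"
      proof (rule row_sum_cong)
        fix k assume k: "k < n"
        show "[N i k = 0] (mod p) \<or> [ent h k j = 0] (mod p)"
        proof (cases "k \<in> L")
          case kL: True
          then have "trivial_row h k"
            using trivial_row_outside[of K h k] h assms k by auto
          then show ?thesis using kL that unfolding trivial_row_def
            by (metis of_bool_eq(1))
        next
          case False
          then show ?thesis using True k assms(4) by blast
        qed
      qed
      then have "[ent h i j - (\<Sum>k<n. N i k * ent h k j) = ent h i j - 0] (mod p)"
        by (intro cong_diff) auto
      then show ?thesis using same[of j] that l by (auto intro: cong_trans)
    next
      case False
      then show ?thesis
        using h(2)[OF that] ent_other[OF i(1) that(1,3) False] i by (metis cong_trans cong_sym)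
    qed
    then show ?thesis using h by blast
  next
    case False
    then have iK: "i \<in> K" using refl by auto
    have "[ent (r i \<otimes> x) l j = ent (r i \<otimes> h) l j] (mod p)" if "l < n" "j \<notin> L" "j < n" for l j
    proof (cases "l = i")
      case True
      then show ?thesis
        using same[of j] that ent_same[OF i(1) that(3) i(3)] by (metis cong_trans cong_sym)
    next
      case False
      then show ?thesis
        using h(2)[OF that] ent_other[OF i(1) that(1,3) False] i by (metis cong_trans cong_sym)
    qed
    moreover have "r i \<otimes> h \<in> gen K" using iK h gen_mult r_in_gen by blast
    ultimately show ?thesis by blast
  qed
qed

lemma r_commute:
  assumes "i < n" "j < n" "i \<noteq> j" "[N i j = 0] (mod p)" "[N j i = 0] (mod p)"
  shows "r i \<otimes> r j = r j \<otimes> r i"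
proof -
  have row: "[ent (r i \<otimes> r j) i c = ent (r i) i c] (mod p)"
    if ij: "i < n" "j < n" "i \<noteq> j" "[N i j = 0] (mod p)" and c: "c < n" for i j c
  proof -
    have rj: "r j = r j \<otimes> \<one>" and ri: "r i = r i \<otimes> \<one>" using ij r_closed by auto
    have "[ent (r i \<otimes> r j) i c = ent \<one> i c - (\<Sum>k<n. N i k * ent \<one> k c)] (mod p)"
    proof (rule ent_same_cong)
      show "[ent (r j) i c = ent \<one> i c] (mod p)"
        using ent_other[of j i c \<one>] ij c rj by simp
      show "[N i k = 0] (mod p) \<or> [ent (r j) k c = ent \<one> k c] (mod p)" if "k < n" for k
        using ent_other[of j k c \<one>] ij c rj that by (cases "k = j") auto
    qed (use ij c r_closed in auto)
    moreover have "[ent (r i) i c = ent \<one> i c - (\<Sum>k<n. N i k * ent \<one> k c)] (mod p)"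
      using ent_same[of i c \<one>] ij c ri by simp
    ultimately show ?thesis by (metis cong_trans cong_sym)
  qed
  have other: "[ent (r i \<otimes> r j) l c = ent (r j) l c] (mod p)"
    if "i < n" "j < n" "l < n" "l \<noteq> i" "c < n" for i j l c
    using ent_other r_closed that by blast
  have triv: "[ent (r i) l c = of_bool (l = c)] (mod p)"
    if "i < n" "l < n" "l \<noteq> i" "c < n" for i l c
    using ent_other[of i l c \<one>] r_closed that ent_one[of l c] by (auto intro: cong_trans)
  show ?thesis
  proof (rule ent_faithful)
    fix l c assume lc: "l < n" "c < n"
    consider "l = i" | "l = j" | "l \<noteq> i" "l \<noteq> j" by blast
    then show "[ent (r i \<otimes> r j) l c = ent (r j \<otimes> r i) l c] (mod p)"
    proof cases
      case 1
      then show ?thesis using row[of i j c] other[of j i l c] assms lc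
        by (metis cong_trans cong_sym)
    next
      case 2
      then show ?thesis using row[of j i c] other[of i j l c] assms lc
        by (metis cong_trans cong_sym)
    next
      case 3
      then show ?thesis using other[of i j l c] other[of j i l c] triv[of i l c] triv[of j l c]
        assms lc by (metis cong_trans cong_sym)
    qed
  qed (use assms r_closed in auto)
qed

text \<open>The generators in \<open>L\<close> commute with \<open>gen K\<close>, so all letters of \<open>K\<close> can be moved to the left.\<close>

lemma gen_split:
  assumes "K \<union> L \<subseteq> {..<n}" "g \<in> gen (K \<union> L)" "K \<inter> L = {}"
    and far: "\<And>i j. i \<in> K \<Longrightarrow> j \<in> L \<Longrightarrow> [N i j = 0] (mod p) \<and> [N j i = 0] (mod p)"
  shows "\<exists>h\<in>gen K. \<exists>k\<in>gen L. g = h \<otimes> k"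
proof -
  have KL: "K \<subseteq> {..<n}" "L \<subseteq> {..<n}" using assms by auto
  have comm: "r j \<otimes> h = h \<otimes> r j" if j: "j \<in> L" and h: "h \<in> gen K" for j h
    using KL(1) h
  proof (induction rule: gen_induct)
    case one
    then show ?case using j KL r_closed by auto
  next
    case (refl i x)
    have c: "r i \<in> carrier G" "r j \<in> carrier G" "x \<in> carrier G"
      using refl j KL r_closed gen_closed[of K] by auto
    have "r i \<otimes> r j = r j \<otimes> r i"
      using far[of i j] refl j assms KL by (intro r_commute) auto
    then show ?case using refl c by (metis m_assoc)
  qed
  show ?thesis using assms(1,2)
  proof (induction rule: gen_induct)
    case one
    have "\<one> = \<one> \<otimes> \<one>" by simp
    then show ?case using one_in_gen by blast
  next
    case (refl i x)
    then obtain h k where hk: "h \<in> gen K" "k \<in> gen L" "x = h \<otimes> k" by blast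
    have c: "r i \<in> carrier G" "h \<in> carrier G" "k \<in> carrier G"
      using refl hk KL r_closed gen_closed[of K] gen_closed[of L] by auto
    show ?case
    proof (cases "i \<in> K")
      case True
      then have "r i \<otimes> x = (r i \<otimes> h) \<otimes> k" "r i \<otimes> h \<in> gen K"
        using hk c gen_mult r_in_gen by (auto simp: m_assoc)
      then show ?thesis using hk by blast
    next
      case False
      then have "i \<in> L" using refl by auto
      then have "r i \<otimes> x = h \<otimes> (r i \<otimes> k)" "r i \<otimes> k \<in> gen L"
        using hk c gen_mult r_in_gen comm[of i h] by (auto simp flip: m_assoc)
      then show ?thesis using hk by blast
    qed
  qed
qed

text \<open>An element of both groups has trivial rows on \<open>I - J\<close> because it lies in \<open>gen J\<close>, so the letters
  of \<open>I - J\<close> can be deleted from a word over \<open>I\<close> that represents it.\<close>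

lemma gen_inter_nonadjacent:
  assumes "I \<subseteq> {..<n}" "J \<subseteq> {..<n}" "g \<in> gen I" "g \<in> gen J"
    and "\<And>i j. i \<in> I \<inter> J \<Longrightarrow> j \<in> I - J \<Longrightarrow> [N i j = 0] (mod p)"
  shows "g \<in> gen (I \<inter> J)"
proof (rule gen_if_trivial_rows[where L = "I - J"])
  have "I \<inter> J \<union> (I - J) = I" by auto
  then show "g \<in> gen (I \<inter> J \<union> (I - J))" using assms by simp
  show "trivial_row g i" if "i \<in> I - J" for i
    using trivial_row_outside[of J g i] assms that by auto
qed (use assms in auto)

end

section \<open>Rank four with an infinite middle branch\<close>

lemma sum_lessThan_4: "(\<Sum>k<4::nat. f k) = f 0 + f 1 + f 2 + (f 3 :: 'a::comm_monoid_add)"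
  by (simp add: eval_nat_numeral)

lemma subset_4_eq_iff:
  assumes "K \<subseteq> {..<4::nat}" "L \<subseteq> {..<4}"
  shows "K = L \<longleftrightarrow> (\<forall>i\<in>{0, 1, 2, 3}. i \<in> K \<longleftrightarrow> i \<in> L)"
proof -
  have "{..<4::nat} = {0, 1, 2, 3}" by auto
  then show ?thesis using assms by blast
qed

lemma less_4_iff: "i < (4::nat) \<longleftrightarrow> i = 0 \<or> i = 1 \<or> i = 2 \<or> i = 3"
  by auto

(* Otherwise the simplifier turns the node 1 into Suc 0, and facts about N 1 2 no longer match. *)
declare One_nat_def [simp del]

locale infinite_middle_branch = mod_reflection_group G 4 p N r ent
  for G (structure) and p N r ent +
  assumes prime_p: "prime p" and p_odd: "p > 2"
    and N_diag: "i < 4 \<Longrightarrow> N i i = 2"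
    and N_far: "i < 4 \<Longrightarrow> j < 4 \<Longrightarrow> i + 2 \<le> j \<Longrightarrow> N i j = 0 \<and> N j i = 0"
    and N_infinite: "N 1 2 * N 2 1 = 4"
begin

lemma N_zero [simp]:
  "N 0 2 = 0" "N 2 0 = 0" "N 0 3 = 0" "N 3 0 = 0" "N 1 3 = 0" "N 3 1 = 0"
  using N_far[of 0 2] N_far[of 0 3] N_far[of 1 3] by simp_all

lemma N_two [simp]: "N 0 0 = 2" "N 1 1 = 2" "N 2 2 = 2" "N 3 3 = 2"
  using N_diag[of 0] N_diag[of 1] N_diag[of 2] N_diag[of 3] by simp_all

lemma not_dvd_2: "\<not> p dvd 2"
  using p_odd zdvd_imp_le by fastforce

lemma dvd_2_mult [simp]: "p dvd 2 * t \<longleftrightarrow> p dvd t"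
  using not_dvd_2 prime_p by (simp add: prime_dvd_mult_iff)

lemma not_dvd_4: "\<not> p dvd 4"
  using dvd_2_mult[of 2] not_dvd_2 by simp

lemma dvd_N_mult [simp]: "p dvd N 1 2 * t \<longleftrightarrow> p dvd t" "p dvd N 2 1 * t \<longleftrightarrow> p dvd t"
proof -
  have "\<not> p dvd N 1 2" "\<not> p dvd N 2 1"
    using not_dvd_4 N_infinite by (metis dvd_mult dvd_mult2)+
  then show "p dvd N 1 2 * t \<longleftrightarrow> p dvd t" "p dvd N 2 1 * t \<longleftrightarrow> p dvd t"
    using prime_p by (simp_all add: prime_dvd_mult_iff)
qed

text \<open>The assumptions are symmetric under reversal of the diagram, so that the results of this
  locale can be applied from either end.\<close>

lemma mirror:
  "infinite_middle_branch G p (\<lambda>i j. N (3 - i) (3 - j)) (\<lambda>i. r (3 - i))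
    (\<lambda>g i j. ent g (3 - i) (3 - j))"
proof unfold_locales
  fix i j g assume "i < (4::nat)" "j < (4::nat)" "g \<in> carrier G"
  moreover have "3 - i < 4" "3 - j < 4" by auto
  ultimately show "[ent (r (3 - i) \<otimes> g) (3 - i) (3 - j) =
      ent g (3 - i) (3 - j) - (\<Sum>k<4. N (3 - i) (3 - k) * ent g (3 - k) (3 - j))] (mod p)"
    using ent_same[of "3 - i" "3 - j" g] by (simp add: sum_lessThan_4 algebra_simps One_nat_def)
next
  fix g h assume *: "g \<in> carrier G" "h \<in> carrier G"
    "\<And>i j. i < 4 \<Longrightarrow> j < 4 \<Longrightarrow> [ent g (3 - i) (3 - j) = ent h (3 - i) (3 - j)] (mod p)"
  show "g = h"
  proof (rule ent_faithful)
    fix i j assume "i < (4::nat)" "j < (4::nat)"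
    then show "[ent g i j = ent h i j] (mod p)" using *(3)[of "3 - i" "3 - j"] by simp
  qed (use * in auto)
next
  fix i j assume "i < (4::nat)" "j < (4::nat)"
  moreover from this have "(3 - i = 3 - j) = (i = j)" by auto
  ultimately show "[ent \<one> (3 - i) (3 - j) = of_bool (i = j)] (mod p)"
    using ent_one[of "3 - i" "3 - j"] by simp
next
  fix i j assume "i < (4::nat)" "j < (4::nat)" "i + 2 \<le> j"
  then show "N (3 - i) (3 - j) = 0 \<and> N (3 - j) (3 - i) = 0"
    using N_far[of "3 - j" "3 - i"] by auto
next
  show "N (3 - 1) (3 - 2) * N (3 - 2) (3 - 1) = 4" using N_infinite by (simp add: mult.commute One_nat_def)
qed (use r_closed r_involution ent_other prime_p p_odd N_diag in auto)

subsection \<open>A partially invariant form\<close>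

text \<open>With \<open>D\<^sub>1 = - N 2 1\<close> and \<open>D\<^sub>2 = - N 1 2\<close> one has \<open>D\<^sub>1 * N 1 2 = D\<^sub>2 * N 2 1\<close>.  The form below is
  the symmetric one with \<open>b\<^sub>i \<sqdot> b\<^sub>j = D\<^sub>i * N i j\<close> whenever \<open>i\<close> is 1 or 2, and so it is invariant under
  \<open>r\<^sub>1\<close> and \<open>r\<^sub>2\<close>.  On the span of \<open>b\<^sub>0\<close> and \<open>b\<^sub>3\<close> this leaves the values open: \<open>b\<^sub>3\<close> gets the square
  norm \<open>c\<close>, to be chosen with regard to \<open>r\<^sub>3\<close>, and all others are 0.\<close>

definition form :: "int \<Rightarrow> (nat \<Rightarrow> int) \<Rightarrow> (nat \<Rightarrow> int) \<Rightarrow> int" where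
  "form c v w =
    (- N 2 1) * (2 * v 1 * w 1 + N 1 0 * (v 0 * w 1 + v 1 * w 0))
    + (- N 1 2) * (2 * v 2 * w 2 + N 2 3 * (v 2 * w 3 + v 3 * w 2))
    + (- N 1 2 * N 2 1) * (v 1 * w 2 + v 2 * w 1) + c * (v 3 * w 3)"

definition reflect :: "nat \<Rightarrow> (nat \<Rightarrow> int) \<Rightarrow> nat \<Rightarrow> int" where
  "reflect i v = v(i := v i - (\<Sum>k<4. N i k * v k))"

lemma form_cong:
  assumes "\<And>i. i < 4 \<Longrightarrow> [v i = v' i] (mod p)" "\<And>i. i < 4 \<Longrightarrow> [w i = w' i] (mod p)"
  shows "[form c v w = form c v' w'] (mod p)"
  unfolding form_def by (intro cong_add cong_mult cong_refl assms) auto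

lemma ent_reflect:
  assumes "i < 4" "l < 4" "j < 4" "g \<in> carrier G"
  shows "[ent (r i \<otimes> g) l j = reflect i (\<lambda>k. ent g k j) l] (mod p)"
  using assms ent_same ent_other by (cases "l = i") (auto simp: reflect_def)

lemma form_reflect_1: "form c (reflect 1 v) (reflect 1 w) = form c v w"
  unfolding form_def reflect_def sum_lessThan_4 by (simp add: algebra_simps)

lemma form_reflect_2: "form c (reflect 2 v) (reflect 2 w) = form c v w"
  unfolding form_def reflect_def sum_lessThan_4 by (simp add: algebra_simps)

text \<open>The hypothesis is the symmetry \<open>D\<^sub>3 * N 3 2 = D\<^sub>2 * N 2 3\<close> that lets \<open>r\<^sub>3\<close> be the reflection in
  \<open>b\<^sub>3\<close> with respect to the form.\<close>

lemma form_reflect_3: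
  assumes "[D * N 3 2 = - (N 1 2 * N 2 3)] (mod p)"
  shows "[form (2 * D) (reflect 3 v) (reflect 3 w) = form (2 * D) v w] (mod p)"
proof -
  have "form (2 * D) (reflect 3 v) (reflect 3 w) - form (2 * D) v w =
      (D * N 3 2 - - (N 1 2 * N 2 3)) * (2 * (v 3 * w 2 + v 2 * w 3 + N 3 2 * v 2 * w 2))"
    unfolding form_def reflect_def sum_lessThan_4 by (simp add: algebra_simps)
  then show ?thesis using assms by (simp add: cong_iff_dvd_diff)
qed

lemma form_invariant:
  assumes "I \<subseteq> {1, 2, 3}" "g \<in> gen I"
    and "3 \<in> I \<Longrightarrow> \<exists>D. c = 2 * D \<and> [D * N 3 2 = - (N 1 2 * N 2 3)] (mod p)"
    and jk: "j < 4" "k < 4"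
  shows "[form c (\<lambda>i. ent g i j) (\<lambda>i. ent g i k) =
    form c (\<lambda>i. of_bool (i = j)) (\<lambda>i. of_bool (i = k))] (mod p)"
proof -
  have I: "I \<subseteq> {..<4}" using assms(1) by auto
  then show ?thesis using assms(2)
  proof (induction rule: gen_induct)
    case one
    show ?case by (rule form_cong) (use ent_one jk in auto)
  next
    case (refl i x)
    have x: "x \<in> carrier G" "i < 4" using refl gen_closed I by auto
    have "[form c (\<lambda>l. ent (r i \<otimes> x) l j) (\<lambda>l. ent (r i \<otimes> x) l k) =
        form c (reflect i (\<lambda>l. ent x l j)) (reflect i (\<lambda>l. ent x l k))] (mod p)"
      by (rule form_cong) (use ent_reflect x jk in auto)
    also have "[form c (reflect i (\<lambda>l. ent x l j)) (reflect i (\<lambda>l. ent x l k)) =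
        form c (\<lambda>l. ent x l j) (\<lambda>l. ent x l k)] (mod p)"
    proof -
      consider "i = 1" | "i = 2" | "i = 3" "3 \<in> I" using refl assms(1) by auto
      then show ?thesis
      proof cases
        case 3
        then show ?thesis using assms(3) form_reflect_3 by auto
      qed (use form_reflect_1 form_reflect_2 in auto)
    qed
    finally show ?case using refl.IH cong_trans by blast
  qed
qed

text \<open>If \<open>N 3 2\<close> is a unit modulo \<open>p\<close>, then \<open>c\<close> can be chosen to make the form invariant under
  \<open>r\<^sub>3\<close>.  Otherwise \<open>r\<^sub>3\<close> fixes \<open>b\<^sub>0, b\<^sub>1, b\<^sub>2\<close>, so \<open>g\<close> acts on them like an element of
  \<open>\<langle>r\<^sub>1, r\<^sub>2\<rangle>\<close>.  The choice of \<open>c\<close> does not show in the result, since row 3 of \<open>g\<close> is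
  trivial and the columns considered therefore have no component at \<open>b\<^sub>3\<close>.\<close>

lemma form_columns:
  assumes g: "g \<in> gen {1, 2, 3}" and "trivial_row g 3" and jk: "j < 3" "k < 3"
    and v: "\<And>i. i < 3 \<Longrightarrow> [ent g i j = v i] (mod p)" "v 3 = 0"
    and w: "\<And>i. i < 3 \<Longrightarrow> [ent g i k = w i] (mod p)" "w 3 = 0"
  shows "[form 0 v w = form 0 (\<lambda>i. of_bool (i = j)) (\<lambda>i. of_bool (i = k))] (mod p)"
proof -
  let ?e = "\<lambda>j i. of_bool (i = j)"
  have row3: "[ent g 3 j = v 3] (mod p)" "[ent g 3 k = w 3] (mod p)"
    using \<open>trivial_row g 3\<close>[unfolded trivial_row_def, rule_format, of j]
      \<open>trivial_row g 3\<close>[unfolded trivial_row_def, rule_format, of k] jk v(2) w(2) by simp_all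
  have "\<exists>c. [form c (\<lambda>i. ent g i j) (\<lambda>i. ent g i k) = form c (?e j) (?e k)] (mod p)"
  proof (cases "p dvd N 3 2")
    case False
    then have "coprime (N 3 2) p"
      using prime_p by (simp add: coprime_commute prime_imp_coprime)
    then obtain u where "[N 3 2 * u = 1] (mod p)" using cong_solve_coprime_int by blast
    then have "[- (N 1 2 * N 2 3) * (N 3 2 * u) = - (N 1 2 * N 2 3) * 1] (mod p)"
      by (rule cong_scalar_left)
    then have D: "[(- (N 1 2 * N 2 3) * u) * N 3 2 = - (N 1 2 * N 2 3)] (mod p)"
      by (simp add: algebra_simps)
    then have "[form (2 * (- (N 1 2 * N 2 3) * u)) (\<lambda>i. ent g i j) (\<lambda>i. ent g i k) =
        form (2 * (- (N 1 2 * N 2 3) * u)) (?e j) (?e k)] (mod p)"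
      using jk by (intro form_invariant[OF subset_refl g] exI[of _ "- (N 1 2 * N 2 3) * u"] conjI refl D) auto
    then show ?thesis by blast
  next
    case True
    have "\<exists>h\<in>gen {1, 2}. \<forall>j<4. j \<notin> {3} \<longrightarrow> (\<forall>i<4. [ent g i j = ent h i j] (mod p))"
    proof (rule agree_off_columns)
      have "{1, 2} \<union> {3} = {1, 2, 3::nat}" by auto
      then show "g \<in> gen ({1, 2} \<union> {3})" using g by simp
      show "[N l i = 0] (mod p)" if "l \<in> {3}" "i < 4" "i \<notin> {3}" for l i
        using that True by (auto simp: less_4_iff cong_0_iff)
    qed auto
    then obtain h where h: "h \<in> gen {1, 2}"
      "\<And>i j. i < 4 \<Longrightarrow> j < 3 \<Longrightarrow> [ent g i j = ent h i j] (mod p)" by auto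
    have "[form 0 (\<lambda>i. ent g i j) (\<lambda>i. ent g i k) = form 0 (\<lambda>i. ent h i j) (\<lambda>i. ent h i k)] (mod p)"
      by (rule form_cong) (use h jk in auto)
    also have "[form 0 (\<lambda>i. ent h i j) (\<lambda>i. ent h i k) = form 0 (?e j) (?e k)] (mod p)"
      by (rule form_invariant[of "{1, 2}"]) (use h jk in auto)
    finally show ?thesis by blast
  qed
  then obtain c where c: "[form c (\<lambda>i. ent g i j) (\<lambda>i. ent g i k) = form c (?e j) (?e k)] (mod p)"
    by blast
  have "[form c v w = form c (\<lambda>i. ent g i j) (\<lambda>i. ent g i k)] (mod p)"
    by (rule form_cong) (use v w row3 in \<open>auto simp: less_4_iff intro: cong_sym\<close>)
  then have "[form c v w = form c (?e j) (?e k)] (mod p)" using c cong_trans by blast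
  moreover have "form c v w = form 0 v w" "form c (?e j) (?e k) = form 0 (?e j) (?e k)"
    using v w jk by (auto simp: form_def)
  ultimately show ?thesis by simp
qed

definition coords :: "int \<Rightarrow> int \<Rightarrow> int \<Rightarrow> nat \<Rightarrow> int" where
  "coords a b c i = (if i = 0 then a else if i = 1 then b else if i = 2 then c else 0)"

text \<open>This is \<open>form_columns\<close> in the shape in which it is applied: the entries of the two columns at
  the nodes 1 and 2 are unknowns, and \<open>t\<close> is the polynomial in them that invariance makes vanish.\<close>

lemma form_coords:
  assumes "g \<in> gen {1, 2, 3}" "trivial_row g 3" "j < 3" "k < 3"
    and "[ent g 1 j = x] (mod p)" "[ent g 2 j = y] (mod p)"
    and "[ent g 1 k = x'] (mod p)" "[ent g 2 k = y'] (mod p)"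
    and "form 0 (coords (of_bool (j = 0)) x y) (coords (of_bool (k = 0)) x' y')
      - form 0 (\<lambda>i. of_bool (i = j)) (\<lambda>i. of_bool (i = k)) = t"
  shows "p dvd t"
proof -
  have "trivial_row g 0" using assms(1) by (intro trivial_row_outside[of "{1, 2, 3}"]) auto
  then have 0: "[ent g 0 l = of_bool (l = 0)] (mod p)" if "l < 4" for l
    using \<open>trivial_row g 0\<close>[unfolded trivial_row_def, rule_format, OF that]
    by (simp add: eq_commute[of 0 l])
  have "[form 0 (coords (of_bool (j = 0)) x y) (coords (of_bool (k = 0)) x' y') =
      form 0 (\<lambda>i. of_bool (i = j)) (\<lambda>i. of_bool (i = k))] (mod p)"
  proof (rule form_columns[OF assms(1-4)])
    have jk: "j < 4" "k < 4" using assms(3,4) by auto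
    fix i :: nat assume "i < 3"
    then consider "i = 0" | "i = 1" | "i = 2" by linarith
    then show "[ent g i j = coords (of_bool (j = 0)) x y i] (mod p)"
      "[ent g i k = coords (of_bool (k = 0)) x' y' i] (mod p)"
      by (cases; simp only: coords_def 0[OF jk(1)] 0[OF jk(2)] assms(5-8) if_True if_False
        zero_neq_one[symmetric] zero_neq_numeral[symmetric] one_eq_numeral_iff
        semiring_norm(85) refl numeral_eq_one_iff)+
  qed (simp_all add: coords_def)
  then show ?thesis using assms(9) by (simp add: cong_iff_dvd_diff)
qed

text \<open>Invariance first puts \<open>g b\<^sub>0 - b\<^sub>0\<close> into the radical of the form on the span of \<open>b\<^sub>1, b\<^sub>2\<close>, as it
  is orthogonal to \<open>b\<^sub>1 = g b\<^sub>1\<close>.  The norm of \<open>g b\<^sub>0\<close> then shows that this difference is orthogonal to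
  \<open>b\<^sub>0\<close>; but \<open>b\<^sub>0\<close> is not orthogonal to the radical when \<open>N 1 0\<close> is a unit.  So \<open>g\<close> fixes \<open>b\<^sub>0\<close>, and the
  products of \<open>g b\<^sub>2\<close> with \<open>b\<^sub>0\<close> and \<open>b\<^sub>1\<close> determine \<open>g b\<^sub>2\<close>.\<close>

lemma columns_trivial:
  assumes g: "g \<in> gen {1, 2, 3}" "trivial_row g 3" and N10: "\<not> p dvd N 1 0"
    and col1: "[ent g 1 1 = 1] (mod p)" "[ent g 2 1 = 0] (mod p)"
    and "i < 4" "j < 3"
  shows "[ent g i j = of_bool (i = j)] (mod p)"
proof -
  let ?x = "ent g 1" and ?y = "ent g 2"
  have "p dvd (- N 2 1) * (2 * ?x 0 + N 1 2 * ?y 0)"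
    by (rule form_coords[OF g, of 1 0 1 0 "?x 0" "?y 0"])
      (use col1 in \<open>auto simp: form_def coords_def algebra_simps\<close>)
  then have 10: "p dvd N 2 1 * (2 * ?x 0 + N 1 2 * ?y 0)" by simp
  have "p dvd (- N 2 1) * (2 * ?x 0 * ?x 0 + 2 * N 1 0 * ?x 0) - 2 * N 1 2 * ?y 0 * ?y 0
      - 2 * N 1 2 * N 2 1 * ?x 0 * ?y 0" (is "p dvd ?q")
    by (rule form_coords[OF g, of 0 0 "?x 0" "?y 0" "?x 0" "?y 0"])
      (auto simp: form_def coords_def algebra_simps)
  \<comment> \<open>Completing the square: the quadratic part of \<open>?q\<close> is a multiple of the square of the linear form
    that 10 makes vanish, because the form has rank one on the span of \<open>b\<^sub>1, b\<^sub>2\<close>.\<close>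
  from dvd_add[OF dvd_diff[OF dvd_mult[OF this, of "- 2"]
        dvd_mult2[OF 10, of "2 * ?x 0 + N 1 2 * ?y 0"]], of "(N 1 2 * N 2 1 - 4) * (N 1 2 * ?y 0 * ?y 0)"]
  have "p dvd (- 2) * ?q
      - (N 2 1 * (2 * ?x 0 + N 1 2 * ?y 0)) * (2 * ?x 0 + N 1 2 * ?y 0)
      + (N 1 2 * N 2 1 - 4) * (N 1 2 * ?y 0 * ?y 0)"
    using N_infinite by simp
  also have "\<dots> = N 2 1 * (2 * (2 * (N 1 0 * ?x 0)))"
    by (simp add: algebra_simps)
  finally have "p dvd N 2 1 * (2 * (2 * (N 1 0 * ?x 0)))" .
  then have "p dvd N 1 0 * ?x 0" by (simp only: dvd_N_mult dvd_2_mult)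
  then have x0: "p dvd ?x 0"
    using N10 prime_p by (simp add: prime_dvd_mult_iff[of p "N 1 0"])
  then have "p dvd N 1 2 * ?y 0"
    using 10 dvd_add_right_iff[of p "2 * ?x 0" "N 1 2 * ?y 0"] by simp
  then have y0: "p dvd ?y 0" by simp
  have "p dvd (- N 2 1) * (N 1 0 * ?x 2)"
    by (rule form_coords[OF g, of 0 2 0 0 "?x 2" "?y 2"])
      (use x0 y0 in \<open>auto simp: form_def coords_def cong_0_iff algebra_simps\<close>)
  then have x2: "p dvd ?x 2"
    using N10 prime_p by (simp add: prime_dvd_mult_iff[of p "N 1 0"])
  have "p dvd (- N 1 2) * (N 2 1 * (?y 2 - 1))"
    by (rule form_coords[OF g, of 1 2 1 0 0 "?y 2"])
      (use x2 col1 in \<open>auto simp: form_def coords_def cong_0_iff algebra_simps\<close>)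
  then have y2: "[?y 2 = 1] (mod p)" by (simp add: cong_iff_dvd_diff)
  have "trivial_row g 0" using g by (intro trivial_row_outside[of "{1, 2, 3}"]) auto
  moreover have "[ent g 1 j = of_bool (1 = j)] (mod p)" "[ent g 2 j = of_bool (2 = j)] (mod p)"
  proof -
    have zero: "[?x 0 = 0] (mod p)" "[?y 0 = 0] (mod p)" "[?x 2 = 0] (mod p)"
      using x0 y0 x2 by (simp_all add: cong_0_iff)
    consider "j = 0" | "j = 1" | "j = 2" using \<open>j < 3\<close> by linarith
    then show "[ent g 1 j = of_bool (1 = j)] (mod p)" "[ent g 2 j = of_bool (2 = j)] (mod p)"
      by (cases; simp add: zero col1 y2)+
  qed
  moreover have "i = 0 \<or> i = 1 \<or> i = 2 \<or> i = 3" using \<open>i < 4\<close> by linarith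
  moreover have "j < 4" using \<open>j < 3\<close> by simp
  ultimately show ?thesis using trivial_rowD g(2) by blast
qed

subsection \<open>The two critical intersections\<close>

text \<open>Such an element moves each vector by a multiple of \<open>b\<^sub>1\<close>.  It fixes \<open>b\<^sub>3\<close>, which is fixed by
  \<open>r\<^sub>0\<close> and \<open>r\<^sub>1\<close>; and it fixes \<open>b\<^sub>0\<close> and \<open>b\<^sub>2\<close>, since their products with the anisotropic fixed
  vector \<open>b\<^sub>1\<close> are preserved.\<close>

lemma inter_01_123_one:
  assumes g: "g \<in> gen {0, 1}" "g \<in> gen {1, 2, 3}" and x1: "[ent g 1 1 = 1] (mod p)"
  shows "g = \<one>"
proof -
  let ?x = "ent g 1"
  have rows: "trivial_row g 0" "trivial_row g 2" "trivial_row g 3"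
    using trivial_row_outside[of "{0, 1}" g] trivial_row_outside[of "{1, 2, 3}" g] g by auto
  have y: "[ent g 2 j = of_bool (2 = j)] (mod p)" if "j < 4" for j
    using rows(2) that by (simp add: trivial_row_def)
  have x3: "[?x 3 = of_bool (1 = (3::nat))] (mod p)"
    by (rule trivial_column[OF _ g(1)]) auto
  have "p dvd (- N 2 1) * (2 * ?x 0)"
    by (rule form_coords[OF g(2) rows(3), of 1 0 1 0 "?x 0" 0])
      (use x1 y[of 0] y[of 1] in \<open>auto simp: form_def coords_def algebra_simps\<close>)
  then have x0: "p dvd ?x 0" by simp
  have "p dvd (- N 2 1) * (2 * ?x 2)"
    by (rule form_coords[OF g(2) rows(3), of 1 2 1 0 "?x 2" 1])
      (use x1 y[of 1] y[of 2] in \<open>auto simp: form_def coords_def algebra_simps\<close>)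
  then have x2: "p dvd ?x 2" by simp
  have "trivial_row g 1"
    using x0 x1 x2 x3 by (auto simp: trivial_row_def less_4_iff cong_0_iff)
  then show ?thesis
    using rows gen_closed[OF _ g(1)] by (intro trivial_imp_one) (auto simp: less_4_iff)
qed

text \<open>The norm of \<open>b\<^sub>1\<close> is preserved, so \<open>b\<^sub>1\<close> goes to \<open>\<plusminus> b\<^sub>1\<close>, and \<open>r\<^sub>1\<close> corrects the sign.\<close>

lemma inter_01_123:
  assumes g: "g \<in> gen {0, 1}" "g \<in> gen {1, 2, 3}"
  shows "g \<in> gen {1}"
proof -
  let ?x = "ent g 1"
  have rows: "trivial_row g 0" "trivial_row g 2" "trivial_row g 3"
    using trivial_row_outside[of "{0, 1}" g] trivial_row_outside[of "{1, 2, 3}" g] g by auto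
  have y1: "[ent g 2 1 = 0] (mod p)" "[ent g 0 1 = 0] (mod p)"
    using trivial_rowD[OF rows(2), of 1] trivial_rowD[OF rows(1), of 1] by simp_all
  have c: "g \<in> carrier G" by (rule gen_closed[OF _ g(1)]) auto
  have "p dvd (- N 2 1) * (2 * ((?x 1 - 1) * (?x 1 + 1)))"
    by (rule form_coords[OF g(2) rows(3), of 1 1 "?x 1" 0 "?x 1" 0])
      (use y1 in \<open>auto simp: form_def coords_def algebra_simps\<close>)
  then consider "[?x 1 = 1] (mod p)" | "[- ?x 1 = 1] (mod p)"
    using prime_p by (auto simp: prime_dvd_mult_iff cong_iff_dvd_diff dvd_diff_commute)
      (metis add.commute diff_minus_eq_add dvd_minus_iff minus_diff_eq)
  then show ?thesis
  proof cases
    case 1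
    then show ?thesis using inter_01_123_one[OF g] one_in_gen by simp
  next
    case 2
    have r1: "r 1 \<otimes> g \<in> gen {0, 1}" "r 1 \<otimes> g \<in> gen {1, 2, 3}"
      using g by (auto intro!: gen_mult r_in_gen)
    have "[ent (r 1 \<otimes> g) 1 1 = reflect 1 (coords 0 (?x 1) 0) 1] (mod p)"
      unfolding reflect_def fun_upd_same
      by (rule ent_same_cong) (use c y1 in \<open>auto simp: less_4_iff coords_def\<close>)
    then have "[ent (r 1 \<otimes> g) 1 1 = 1] (mod p)"
      using 2 by (auto simp: reflect_def sum_lessThan_4 coords_def intro: cong_trans)
    then have "r 1 \<otimes> g = \<one>" by (rule inter_01_123_one[OF r1])
    then have "g = r 1" using r_cancel[of 1 g] c r_closed[of 1] by simp
    then show ?thesis using r_in_gen by simp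
  qed
qed

text \<open>The columns 0, 1, 2 are controlled by \<open>\<langle>r\<^sub>1, r\<^sub>2, r\<^sub>3\<rangle>\<close>; since this includes the column
  of \<open>b\<^sub>2\<close>, the reversed statement for \<open>\<langle>r\<^sub>0, r\<^sub>1, r\<^sub>2\<rangle>\<close> applies and yields column 3.\<close>

lemma inter_012_123_one:
  assumes g: "g \<in> gen {0, 1, 2}" "g \<in> gen {1, 2, 3}"
    and N: "\<not> p dvd N 1 0" "\<not> p dvd N 2 3"
    and col1: "[ent g 1 1 = 1] (mod p)" "[ent g 2 1 = 0] (mod p)"
  shows "g = \<one>"
proof -
  interpret mirror: infinite_middle_branch G p "\<lambda>i j. N (3 - i) (3 - j)" "\<lambda>i. r (3 - i)"
    "\<lambda>g i j. ent g (3 - i) (3 - j)"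
    by (rule mirror)
  have rows: "trivial_row g 0" "trivial_row g 3"
    using trivial_row_outside[of "{0, 1, 2}" g] trivial_row_outside[of "{1, 2, 3}" g] g by auto
  have left: "[ent g i j = of_bool (i = j)] (mod p)" if "i < 4" "j < 3" for i j
    by (rule columns_trivial) (use rows g N col1 that in auto)
  have right: "[ent g i 3 = of_bool (i = 3)] (mod p)" if "i < 4" for i
  proof -
    have "[ent g (3 - (3 - i)) (3 - 0) = of_bool (3 - i = (0::nat))] (mod p)"
    proof (rule mirror.columns_trivial)
      show "g \<in> mirror.gen {1, 2, 3}"
        using g(1) by (simp add: mirror.gen_def gen_def insert_commute One_nat_def)
      show "mirror.trivial_row g 3"
        unfolding mirror.trivial_row_def
      proof (intro allI impI)
        fix j :: nat assume "j < 4"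
        then have "(0 = 3 - j) = (3 = j)" by auto
        then show "[ent g (3 - 3) (3 - j) = of_bool (3 = j)] (mod p)"
          using trivial_rowD[OF rows(1), of "3 - j"] by simp
      qed
    qed (use N left[of 2 2] left[of 1 2] in \<open>auto simp: One_nat_def\<close>)
    moreover have "3 - i = 0 \<longleftrightarrow> i = 3" using that by auto
    ultimately show ?thesis using that by simp
  qed
  show ?thesis
  proof (rule trivial_imp_one)
    show "trivial_row g i" if "i < 4" for i
      unfolding trivial_row_def
    proof (intro allI impI)
      fix j :: nat assume "j < 4"
      then have "j < 3 \<or> j = 3" by auto
      then show "[ent g i j = of_bool (i = j)] (mod p)" using left[OF that] right[OF that] by blast
    qed
    show "g \<in> carrier G" by (rule gen_closed[OF _ g(1)]) auto
  qed
qed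

text \<open>The product \<open>r\<^sub>1 r\<^sub>2\<close> fixes the radical vector \<open>z = 2 b\<^sub>1 - N 2 1 b\<^sub>2\<close> and maps \<open>b\<^sub>1\<close> to \<open>b\<^sub>1 + z\<close>.
  The column is \<open>b\<^sub>1 + s z\<close>.\<close>

lemma translate_column:
  assumes "g \<in> carrier G" "[ent g 0 1 = 0] (mod p)" "[ent g 3 1 = 0] (mod p)"
    and "[ent g 1 1 = 1 + 2 * s] (mod p)" "[ent g 2 1 = - (N 2 1 * s)] (mod p)"
  shows "\<exists>h\<in>gen {1, 2}. [ent (h \<otimes> g) 1 1 = 1 + 2 * (s + int m)] (mod p) \<and>
    [ent (h \<otimes> g) 2 1 = - (N 2 1 * (s + int m))] (mod p)"
  using assms
proof (induction m arbitrary: g s)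
  case 0
  then show ?case by (intro bexI[of _ \<one>]) (auto simp: one_in_gen)
next
  case (Suc m)
  let ?y = "- (N 2 1 * (s + 1))" and ?g = "r 1 \<otimes> (r 2 \<otimes> g)"
  have c: "g \<in> carrier G" "r 1 \<in> carrier G" "r 2 \<in> carrier G" using Suc r_closed by auto
  have "[ent (r 2 \<otimes> g) 2 1 = reflect 2 (coords 0 (1 + 2 * s) (- (N 2 1 * s))) 2] (mod p)"
    unfolding reflect_def fun_upd_same
    by (rule ent_same_cong) (use Suc.prems in \<open>auto simp: less_4_iff coords_def\<close>)
  moreover have "reflect 2 (coords 0 (1 + 2 * s) (- (N 2 1 * s))) 2 = ?y"
    by (simp add: reflect_def sum_lessThan_4 coords_def algebra_simps)
  ultimately have 2: "[ent (r 2 \<otimes> g) 2 1 = ?y] (mod p)" by simp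
  have o2: "[ent (r 2 \<otimes> g) l 1 = v] (mod p)" if "l < 4" "l \<noteq> 2" "[ent g l 1 = v] (mod p)" for l v
    using ent_other[of 2 l 1 g] that c by (auto intro: cong_trans)
  have "[ent ?g 1 1 = reflect 1 (coords 0 (1 + 2 * s) ?y) 1] (mod p)"
    unfolding reflect_def fun_upd_same
    by (rule ent_same_cong) (use Suc.prems 2 o2 c in \<open>auto simp: less_4_iff coords_def\<close>)
  moreover have "reflect 1 (coords 0 (1 + 2 * s) ?y) 1 = N 1 2 * N 2 1 * (s + 1) - 1 - 2 * s"
    by (simp add: reflect_def sum_lessThan_4 coords_def algebra_simps)
  ultimately have 1: "[ent ?g 1 1 = 1 + 2 * (s + 1)] (mod p)"
    using N_infinite by (simp add: algebra_simps)
  have o1: "[ent ?g l 1 = v] (mod p)" if "l < 4" "l \<noteq> 1" "[ent (r 2 \<otimes> g) l 1 = v] (mod p)" for l v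
    using ent_other[of 1 l 1 "r 2 \<otimes> g"] that c by (auto intro: cong_trans)
  obtain h where h: "h \<in> gen {1, 2}" "[ent (h \<otimes> ?g) 1 1 = 1 + 2 * (s + 1 + int m)] (mod p)"
    "[ent (h \<otimes> ?g) 2 1 = - (N 2 1 * (s + 1 + int m))] (mod p)"
    using Suc.IH[of ?g "s + 1"] 1 2 o1 o2 Suc.prems c by auto
  have "h \<in> carrier G" by (rule gen_closed[OF _ h(1)]) auto
  then have "h \<otimes> ?g = (h \<otimes> (r 1 \<otimes> r 2)) \<otimes> g" using c by (simp add: m_assoc)
  moreover have "h \<otimes> (r 1 \<otimes> r 2) \<in> gen {1, 2}"
    using h(1) by (intro gen_mult r_in_gen) auto
  ultimately show ?case using h by (intro bexI[of _ "h \<otimes> (r 1 \<otimes> r 2)"]) (auto simp: algebra_simps)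
qed

text \<open>The form on the span of \<open>b\<^sub>1, b\<^sub>2\<close> is a multiple of the square of the linear form
  \<open>N 2 1 x + 2 y\<close>, which kills the radical; hence this linear form has the same value on \<open>g b\<^sub>1\<close> as
  on \<open>b\<^sub>1\<close>, up to sign.  The reflection \<open>r\<^sub>1\<close> corrects the sign, after which \<open>g b\<^sub>1\<close> and \<open>b\<^sub>1\<close>
  differ by a multiple of the radical vector.\<close>

lemma normalize_column:
  assumes g: "g \<in> gen {1, 2, 3}" "trivial_row g 3"
  shows "\<exists>h\<in>gen {1, 2}. [ent (h \<otimes> g) 1 1 = 1] (mod p) \<and> [ent (h \<otimes> g) 2 1 = 0] (mod p)"
proof -
  have normalize: "\<exists>h\<in>gen {1, 2}. [ent (h \<otimes> g) 1 1 = 1] (mod p) \<and> [ent (h \<otimes> g) 2 1 = 0] (mod p)"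
    if g: "g \<in> carrier G" "[ent g 0 1 = 0] (mod p)" "[ent g 3 1 = 0] (mod p)"
      and l: "p dvd N 2 1 * ent g 1 1 + 2 * ent g 2 1 - N 2 1" for g
  proof -
    have "coprime 2 p"
      using prime_imp_coprime[OF prime_p not_dvd_2] by (simp add: coprime_commute)
    then obtain u where "[2 * u = 1] (mod p)" using cong_solve_coprime_int by blast
    then have "[(2 * u) * (ent g 1 1 - 1) = 1 * (ent g 1 1 - 1)] (mod p)"
      by (rule cong_scalar_right)
    then obtain s where s: "[2 * s = ent g 1 1 - 1] (mod p)" by (metis mult.assoc mult_1)
    have "[1 + 2 * s = 1 + (ent g 1 1 - 1)] (mod p)" by (rule cong_add[OF cong_refl s])
    then have x: "[ent g 1 1 = 1 + 2 * s] (mod p)" by (simp add: cong_sym_eq)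
    have "p dvd (N 2 1 * ent g 1 1 + 2 * ent g 2 1 - N 2 1) + N 2 1 * (2 * s - (ent g 1 1 - 1))"
      using l s by (simp add: cong_iff_dvd_diff)
    then have "p dvd 2 * (ent g 2 1 + N 2 1 * s)" by (simp add: algebra_simps)
    then have "p dvd ent g 2 1 + N 2 1 * s" by (simp only: dvd_2_mult)
    then have y: "[ent g 2 1 = - (N 2 1 * s)] (mod p)" by (simp add: cong_iff_dvd_diff)
    define m where "m = nat ((- s) mod p)"
    have "[s + int m = s + - s] (mod p)"
      unfolding m_def using p_odd by (intro cong_add) (auto simp: cong_def)
    then have "p dvd s + int m" by (simp add: cong_0_iff)
    then have "[1 + 2 * (s + int m) = 1] (mod p)" "[- (N 2 1 * (s + int m)) = 0] (mod p)"
      by (simp_all only: cong_iff_dvd_diff add_diff_cancel_left' diff_zero dvd_minus_iff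
        dvd_2_mult dvd_N_mult)
    then show ?thesis using translate_column[OF g x y, of m] by (meson cong_trans)
  qed
  have c: "g \<in> carrier G" by (rule gen_closed[OF _ g(1)]) auto
  have "trivial_row g 0" using g(1) by (intro trivial_row_outside[of "{1, 2, 3}"]) auto
  then have z: "[ent g 0 1 = 0] (mod p)" "[ent g 3 1 = 0] (mod p)"
    using trivial_rowD[OF _ , of g 0 1] trivial_rowD[OF g(2), of 1] \<open>trivial_row g 0\<close> by simp_all
  let ?x = "ent g 1 1" and ?y = "ent g 2 1"
  have "p dvd (- 2) * (N 2 1 * ?x * ?x + N 1 2 * ?y * ?y + N 1 2 * N 2 1 * ?x * ?y - N 2 1)"
    (is "p dvd _ * ?q")
    by (rule form_coords[OF g, of 1 1 ?x ?y ?x ?y]) (auto simp: form_def coords_def algebra_simps)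
  then have "p dvd ?q" by (simp only: mult_minus_left dvd_minus_iff dvd_2_mult)
  moreover have "(N 2 1 * ?x + 2 * ?y - N 2 1) * (N 2 1 * ?x + 2 * ?y + N 2 1) =
      N 2 1 * ?q + (4 - N 1 2 * N 2 1) * (?y * ?y + N 2 1 * ?x * ?y)"
    by (simp add: algebra_simps)
  ultimately have "p dvd (N 2 1 * ?x + 2 * ?y - N 2 1) * (N 2 1 * ?x + 2 * ?y + N 2 1)"
    using N_infinite by simp
  then consider "p dvd N 2 1 * ?x + 2 * ?y - N 2 1" | "p dvd N 2 1 * ?x + 2 * ?y + N 2 1"
    using prime_p prime_dvd_mult_iff by blast
  then show ?thesis
  proof cases
    case 1
    then show ?thesis using normalize c z by blast
  next
    case 2
    let ?g = "r 1 \<otimes> g"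
    have r1: "r 1 \<in> carrier G" using r_closed by simp
    have o1: "[ent ?g l 1 = v] (mod p)" if "l < 4" "l \<noteq> 1" "[ent g l 1 = v] (mod p)" for l v
      using ent_other[of 1 l 1 g] that c by (auto intro: cong_trans)
    have "[ent ?g 1 1 = reflect 1 (coords 0 ?x ?y) 1] (mod p)"
      unfolding reflect_def fun_upd_same
      by (rule ent_same_cong) (use z c in \<open>auto simp: less_4_iff coords_def\<close>)
    then have "[ent ?g 1 1 = - ?x - N 1 2 * ?y] (mod p)"
      by (simp add: reflect_def sum_lessThan_4 coords_def)
    moreover have "[ent ?g 2 1 = ?y] (mod p)" by (rule o1) auto
    ultimately have "[N 2 1 * ent ?g 1 1 + 2 * ent ?g 2 1 - N 2 1 =
        N 2 1 * (- ?x - N 1 2 * ?y) + 2 * ?y - N 2 1] (mod p)"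
      by (intro cong_add cong_diff cong_mult cong_refl)
    also have "N 2 1 * (- ?x - N 1 2 * ?y) + 2 * ?y - N 2 1 =
        (4 - N 1 2 * N 2 1) * ?y - (N 2 1 * ?x + 2 * ?y + N 2 1)"
      by (simp add: algebra_simps)
    also have "[\<dots> = 0] (mod p)" using dvd_minus_iff[THEN iffD2, OF 2] N_infinite by (simp add: cong_0_iff)
    finally have "p dvd N 2 1 * ent ?g 1 1 + 2 * ent ?g 2 1 - N 2 1" by (simp add: cong_0_iff)
    then obtain h where h: "h \<in> gen {1, 2}" "[ent (h \<otimes> ?g) 1 1 = 1] (mod p)"
      "[ent (h \<otimes> ?g) 2 1 = 0] (mod p)"
      using normalize[of ?g] o1 z c r1 by auto
    have "h \<in> carrier G" by (rule gen_closed[OF _ h(1)]) auto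
    then have "h \<otimes> ?g = (h \<otimes> r 1) \<otimes> g" using c r1 by (simp add: m_assoc)
    moreover have "h \<otimes> r 1 \<in> gen {1, 2}" using h(1) by (intro gen_mult r_in_gen) auto
    ultimately show ?thesis using h by metis
  qed
qed

lemma inter_012_123:
  assumes g: "g \<in> gen {0, 1, 2}" "g \<in> gen {1, 2, 3}"
  shows "g \<in> gen {1, 2}"
proof -
  have rows: "trivial_row g 0" "trivial_row g 3"
    using trivial_row_outside[of "{0, 1, 2}" g] trivial_row_outside[of "{1, 2, 3}" g] g by auto
  consider "p dvd N 1 0" | "p dvd N 2 3" | "\<not> p dvd N 1 0" "\<not> p dvd N 2 3" by blast
  then show ?thesis
  proof cases
    case 1
    show ?thesis
    proof (rule gen_if_trivial_rows[where L = "{0}"])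
      show "g \<in> gen ({1, 2} \<union> {0})" using g(1) by (simp add: insert_commute)
    qed (use 1 rows in \<open>auto simp: cong_0_iff\<close>)
  next
    case 2
    show ?thesis
    proof (rule gen_if_trivial_rows[where L = "{3}"])
      show "g \<in> gen ({1, 2} \<union> {3})" using g(2) by (simp add: insert_commute)
    qed (use 2 rows in \<open>auto simp: cong_0_iff\<close>)
  next
    case 3
    obtain h where h: "h \<in> gen {1, 2}" "[ent (h \<otimes> g) 1 1 = 1] (mod p)"
      "[ent (h \<otimes> g) 2 1 = 0] (mod p)"
      using normalize_column[OF g(2) rows(2)] by blast
    have "h \<in> gen {0, 1, 2}" "h \<in> gen {1, 2, 3}"
      using h(1) gen_mono[of "{1, 2}" "{0, 1, 2}"] gen_mono[of "{1, 2}" "{1, 2, 3}"] by auto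
    then have "h \<otimes> g = \<one>"
      using g h 3 by (intro inter_012_123_one gen_mult)
    moreover have c: "h \<in> carrier G" "g \<in> carrier G" using gen_closed[OF _ h(1)] gen_closed[OF _ g(1)] by auto
    ultimately have "g = inv h" by (metis inv_equality inv_inv)
    then show ?thesis using gen_inv[OF _ h(1)] by auto
  qed
qed

subsection \<open>The intersection property\<close>

text \<open>Here node 0 is adjacent to \<open>I \<inter> J\<close> from the side of \<open>I\<close> and node 2 from the side of \<open>J\<close>.  Only the
  position of node 3 is open; it commutes with the rest of \<open>I\<close> and can be split off or dropped.\<close>

lemma gen_inter_at_1:
  assumes IJ: "I \<subseteq> {..<4}" "J \<subseteq> {..<4}" and g: "g \<in> gen I" "g \<in> gen J"
    and "0 \<in> I" "0 \<notin> J" "1 \<in> I" "1 \<in> J" "2 \<notin> I" "2 \<in> J"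
  shows "g \<in> gen (I \<inter> J)"
proof -
  have I: "I = {0, 1} \<union> (I \<inter> {3})" and J: "J \<subseteq> {1, 2, 3}"
    using assms by (auto simp: less_4_iff)
  have far: "[N i j = 0] (mod p) \<and> [N j i = 0] (mod p)" if "i \<in> {0, 1}" "j \<in> I \<inter> {3}" for i j
    using that by auto
  obtain h k where hk: "h \<in> gen {0, 1}" "k \<in> gen (I \<inter> {3})" "g = h \<otimes> k"
    using gen_split[of "{0, 1}" "I \<inter> {3}" g, OF _ _ _ far] g(1) I IJ by auto
  have c: "h \<in> carrier G" "k \<in> carrier G"
    using gen_closed[OF _ hk(1)] gen_closed[OF _ hk(2)] by (auto simp: subset_iff)
  show ?thesis
  proof (cases "3 \<in> J")
    case True
    then have k: "k \<in> gen (I \<inter> J)" using hk(2) gen_mono[of "I \<inter> {3}" "I \<inter> J"] by auto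
    then have "k \<in> gen J" using gen_mono[of "I \<inter> J" J] by auto
    then have "g \<otimes> inv k \<in> gen J" using g(2) IJ(2) gen_mult gen_inv by blast
    then have "h \<in> gen {1, 2, 3}"
      using hk(3) c J gen_mono[of J "{1, 2, 3}"] by (auto simp: m_assoc)
    then have "h \<in> gen {1}" using hk(1) inter_01_123 by blast
    then have "h \<in> gen (I \<inter> J)" using gen_mono[of "{1}" "I \<inter> J"] assms by auto
    then show ?thesis using hk(3) k gen_mult by blast
  next
    case False
    have "g \<in> gen {0, 1}"
    proof (rule gen_if_trivial_rows[where L = "I \<inter> {3}"])
      show "g \<in> gen ({0, 1} \<union> I \<inter> {3})" using g(1) I by simp
      show "trivial_row g i" if "i \<in> I \<inter> {3}" for i
        using that False g(2) IJ trivial_row_outside[of J] by auto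
    qed (use far in auto)
    then have "g \<in> gen {1}" using inter_01_123 g(2) gen_mono[OF J] by blast
    then show ?thesis using gen_mono[of "{1}" "I \<inter> J"] assms by auto
  qed
qed

lemma mirror_gen:
  assumes "I \<subseteq> {..<4}"
  shows "mod_reflection_group.gen G (\<lambda>i. r (3 - i)) ((\<lambda>i. 3 - i) ` I) = gen I"
proof -
  interpret mirror: infinite_middle_branch G p "\<lambda>i j. N (3 - i) (3 - j)" "\<lambda>i. r (3 - i)"
    "\<lambda>g i j. ent g (3 - i) (3 - j)"
    by (rule mirror)
  have "(\<lambda>i. r (3 - i)) ` ((\<lambda>i. 3 - i) ` I) = r ` I"
    unfolding image_image
  proof (intro image_cong refl)
    fix i assume "i \<in> I"
    then have "i < 4" using assms by auto
    then show "r (3 - (3 - i)) = r i" by simp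
  qed
  then show ?thesis by (simp add: mirror.gen_def gen_def)
qed

lemma gen_inter_at_2:
  assumes IJ: "I \<subseteq> {..<4}" "J \<subseteq> {..<4}" and g: "g \<in> gen I" "g \<in> gen J"
    and "3 \<in> I" "3 \<notin> J" "2 \<in> I" "2 \<in> J" "1 \<notin> I" "1 \<in> J"
  shows "g \<in> gen (I \<inter> J)"
proof -
  interpret mirror: infinite_middle_branch G p "\<lambda>i j. N (3 - i) (3 - j)" "\<lambda>i. r (3 - i)"
    "\<lambda>g i j. ent g (3 - i) (3 - j)"
    by (rule mirror)
  let ?m = "\<lambda>i. 3 - i :: nat"
  have mem: "j \<in> ?m ` K \<longleftrightarrow> 3 - j \<in> K" if "j < 4" "K \<subseteq> {..<4}" for j K
  proof
    assume "j \<in> ?m ` K"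
    then obtain i where "i \<in> K" "j = 3 - i" by blast
    moreover from this have "i < 4" using that by auto
    ultimately show "3 - j \<in> K" by simp
  next
    assume "3 - j \<in> K"
    moreover have "j = 3 - (3 - j)" using that by simp
    ultimately show "j \<in> ?m ` K" by (rule rev_image_eqI)
  qed
  have mem: "0 \<in> ?m ` K \<longleftrightarrow> 3 \<in> K" "1 \<in> ?m ` K \<longleftrightarrow> 2 \<in> K" "2 \<in> ?m ` K \<longleftrightarrow> 1 \<in> K"
    if "K \<subseteq> {..<4}" for K
    using mem[of 0 K] mem[of 1 K] mem[of 2 K] that by (simp_all add: One_nat_def)
  have "?m ` (I \<inter> J) = ?m ` I \<inter> ?m ` J"
    using IJ by (intro inj_on_image_Int[of _ "{..<4}"]) (auto simp: inj_on_def)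
  moreover have "g \<in> mirror.gen (?m ` I \<inter> ?m ` J)"
  proof (rule mirror.gen_inter_at_1)
    show "?m ` I \<subseteq> {..<4}" "?m ` J \<subseteq> {..<4}" by auto
    show "g \<in> mirror.gen (?m ` I)" "g \<in> mirror.gen (?m ` J)"
      using g mirror_gen[OF IJ(1)] mirror_gen[OF IJ(2)] by simp_all
  qed (use assms(5-) in \<open>simp_all only: mem[OF IJ(1)] mem[OF IJ(2)] simp_thms\<close>)
  moreover have "I \<inter> J \<subseteq> {..<4}" using IJ by auto
  ultimately show ?thesis using mirror_gen[of "I \<inter> J"] by simp
qed

lemma inter_013_023:
  assumes g: "g \<in> gen {0, 1, 3}" "g \<in> gen {0, 2, 3}"
  shows "g \<in> gen {0, 3}"
proof -
  have "\<exists>h\<in>gen {0, 1}. \<exists>k\<in>gen {3}. g = h \<otimes> k"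
    by (rule gen_split) (use g in \<open>auto simp: insert_commute\<close>)
  then obtain h k where hk: "h \<in> gen {0, 1}" "k \<in> gen {3}" "g = h \<otimes> k" by blast
  have c: "h \<in> carrier G" "k \<in> carrier G"
    using hk gen_closed[of "{0, 1}"] gen_closed[of "{3}"] by auto
  have k: "k \<in> gen {0, 3}" "k \<in> gen {0, 2, 3}"
    using hk(2) gen_mono[of "{3}" "{0, 3}"] gen_mono[of "{3}" "{0, 2, 3}"] by auto
  have "g \<otimes> inv k \<in> gen {0, 2, 3}" using g(2) k(2) by (intro gen_mult gen_inv) auto
  then have "h \<in> gen {0, 2, 3}" using hk(3) c by (simp add: m_assoc)
  then have "h \<in> gen ({0, 2, 3} \<inter> {0, 1})"
    using hk(1) by (intro gen_inter_nonadjacent) auto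
  then have "h \<in> gen {0, 3}" using gen_mono[of "{0, 2, 3} \<inter> {0, 1}" "{0, 3}"] by auto
  then show ?thesis using k(1) hk(3) gen_mult by blast
qed

text \<open>In a counterexample, \<open>I \<inter> J\<close> is adjacent both to \<open>I - J\<close> and to \<open>J - I\<close>, by
  \<open>gen_inter_nonadjacent\<close>.  On a path with four nodes this leaves, up to exchanging \<open>I\<close> and \<open>J\<close> and
  up to reversal, only the situations treated above.\<close>

theorem intersection_property:
  assumes IJ: "I \<subseteq> {..<4}" "J \<subseteq> {..<4}"
  shows "gen I \<inter> gen J = gen (I \<inter> J)"
proof
  show "gen (I \<inter> J) \<subseteq> gen I \<inter> gen J" using gen_mono by simp
  show "gen I \<inter> gen J \<subseteq> gen (I \<inter> J)"
  proof
    fix g assume "g \<in> gen I \<inter> gen J"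
    then have g: "g \<in> gen I" "g \<in> gen J" by auto
    show "g \<in> gen (I \<inter> J)"
    proof (rule ccontr)
      assume no: "g \<notin> gen (I \<inter> J)"
      have adjacent: "\<exists>i\<in>I \<inter> J. \<exists>j\<in>I - J. i = Suc j \<or> j = Suc i"
        if "I \<subseteq> {..<4}" "J \<subseteq> {..<4}" "g \<in> gen I" "g \<in> gen J" "g \<notin> gen (I \<inter> J)" for I J
      proof (rule ccontr)
        assume far: "\<not> ?thesis"
        then have "[N i j = 0] (mod p)" if "i \<in> I \<inter> J" "j \<in> I - J" for i j
        proof -
          have "i + 2 \<le> j \<or> j + 2 \<le> i" using far that by (metis DiffD2 IntD2 Suc_leI
            add_2_eq_Suc' le_less_Suc_eq linorder_neqE_nat not_less_eq_eq)
          then show ?thesis using N_far[of i j] N_far[of j i] that \<open>I \<subseteq> _\<close> by auto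
        qed
        then show False using gen_inter_nonadjacent that by blast
      qed
      have no_split: "\<not> (0 \<in> I \<and> 0 \<notin> J \<and> 1 \<in> I \<and> 1 \<in> J \<and> 2 \<notin> I \<and> 2 \<in> J)"
        "\<not> (0 \<in> J \<and> 0 \<notin> I \<and> 1 \<in> I \<and> 1 \<in> J \<and> 2 \<notin> J \<and> 2 \<in> I)"
        "\<not> (3 \<in> I \<and> 3 \<notin> J \<and> 2 \<in> I \<and> 2 \<in> J \<and> 1 \<notin> I \<and> 1 \<in> J)"
        "\<not> (3 \<in> J \<and> 3 \<notin> I \<and> 2 \<in> I \<and> 2 \<in> J \<and> 1 \<notin> J \<and> 1 \<in> I)"
        using no gen_inter_at_1[of I J g] gen_inter_at_1[of J I g]
          gen_inter_at_2[of I J g] gen_inter_at_2[of J I g] IJ g by (auto simp: Int_commute)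
      have adj_cases: "0 \<in> I \<and> 1 \<in> I - J \<and> 0 \<in> J \<or> 1 \<in> I \<and> 0 \<in> I - J \<and> 1 \<in> J
          \<or> 1 \<in> I \<and> 2 \<in> I - J \<and> 1 \<in> J \<or> 2 \<in> I \<and> 1 \<in> I - J \<and> 2 \<in> J
          \<or> 2 \<in> I \<and> 3 \<in> I - J \<and> 2 \<in> J \<or> 3 \<in> I \<and> 2 \<in> I - J \<and> 3 \<in> J"
        if adj: "\<exists>i\<in>I \<inter> J. \<exists>j\<in>I - J. i = Suc j \<or> j = Suc i" and sub: "I \<subseteq> {..<4}" for I J
      proof -
        obtain i j where ij: "i \<in> I" "i \<in> J" "j \<in> I - J" "i = Suc j \<or> j = Suc i"
          using adj by auto
        then have "i < 4" "j < 4" using sub by auto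
        then show ?thesis
          using ij unfolding less_4_iff by (elim disjE; simp add: One_nat_def)
      qed
      have "g \<notin> gen (J \<inter> I)" using no by (simp add: Int_commute)
      note A = adj_cases[OF adjacent[OF IJ g no] IJ(1)]
        and B = adj_cases[OF adjacent[OF IJ(2,1) g(2,1) this] IJ(2)]
      have sets: "K = {0, 1, 2} \<longleftrightarrow> 0 \<in> K \<and> 1 \<in> K \<and> 2 \<in> K \<and> 3 \<notin> K"
        "K = {1, 2, 3} \<longleftrightarrow> 0 \<notin> K \<and> 1 \<in> K \<and> 2 \<in> K \<and> 3 \<in> K"
        "K = {0, 1, 3} \<longleftrightarrow> 0 \<in> K \<and> 1 \<in> K \<and> 2 \<notin> K \<and> 3 \<in> K"
        "K = {0, 2, 3} \<longleftrightarrow> 0 \<in> K \<and> 1 \<notin> K \<and> 2 \<in> K \<and> 3 \<in> K"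
        if "K \<subseteq> {..<4}" for K :: "nat set"
        by (simp_all add: subset_4_eq_iff[OF that])
      have "(I = {0, 1, 2} \<and> J = {1, 2, 3}) \<or> (J = {0, 1, 2} \<and> I = {1, 2, 3}) \<or>
          (I = {0, 1, 3} \<and> J = {0, 2, 3}) \<or> (J = {0, 1, 3} \<and> I = {0, 2, 3})"
        unfolding sets[OF IJ(1)] sets[OF IJ(2)] using A B no_split by (elim disjE; simp)
      then show False
        using no g inter_012_123 inter_013_023 by (auto simp: Int_insert_left)
    qed
  qed
qed

end


section \<open>Reduced reflection matrices\<close>

lemma elements_mat_subset_iff:
  "A \<in> carrier_mat n n \<Longrightarrow> elements_mat A \<subseteq> S \<longleftrightarrow> (\<forall>i<n. \<forall>j<n. A $$ (i, j) \<in> S)"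
  by (auto dest!: elements_matD intro!: elements_matI)

lemma carrier_residue_mat_monoid:
  "A \<in> carrier (residue_mat_monoid n p) \<longleftrightarrow>
    A \<in> carrier_mat n n \<and> (\<forall>i<n. \<forall>j<n. 0 \<le> A $$ (i, j) \<and> A $$ (i, j) < int p)"
  by (auto simp: residue_mat_monoid_def elements_mat_subset_iff)

lemma reduce_mat_carrier [simp]: "reduce_mat p A \<in> carrier_mat n m \<longleftrightarrow> A \<in> carrier_mat n m"
  by (simp add: reduce_mat_def)

lemma reduce_mat_in_monoid:
  "p > 0 \<Longrightarrow> A \<in> carrier_mat n n \<Longrightarrow> reduce_mat p A \<in> carrier (residue_mat_monoid n p)"
  unfolding carrier_residue_mat_monoid by (auto simp: reduce_mat_def)

lemma reduce_mat_id: "A \<in> carrier (residue_mat_monoid n p) \<Longrightarrow> reduce_mat p A = A"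
  unfolding carrier_residue_mat_monoid by (intro eq_matI) (auto simp: reduce_mat_def)

lemma mult_mat_entry:
  assumes "A \<in> carrier_mat n n" "B \<in> carrier_mat n n" "i < n" "j < n"
  shows "(A * B) $$ (i, j) = (\<Sum>k<n. A $$ (i, k) * B $$ (k, j))"
  using assms by (simp add: scalar_prod_def atLeast0LessThan)

lemma reduce_mat_mult_reduce:
  assumes A: "A \<in> carrier_mat n n" and B: "B \<in> carrier_mat n n"
  shows "reduce_mat p (reduce_mat p A * B) = reduce_mat p (A * B)"
    and "reduce_mat p (A * reduce_mat p B) = reduce_mat p (A * B)"
proof -
  have AB: "reduce_mat p A \<in> carrier_mat n n" "reduce_mat p B \<in> carrier_mat n n"
    using A B by simp_all
  have "(reduce_mat p A * B) $$ (i, j) mod int p = (A * B) $$ (i, j) mod int p"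
    "(A * reduce_mat p B) $$ (i, j) mod int p = (A * B) $$ (i, j) mod int p"
    if "i < n" "j < n" for i j
    unfolding mult_mat_entry[OF A B that] mult_mat_entry[OF AB(1) B that]
      mult_mat_entry[OF A AB(2) that] cong_def[symmetric]
    by (intro cong_sum cong_mult; use A B that in \<open>simp add: reduce_mat_def cong_def\<close>)+
  then show "reduce_mat p (reduce_mat p A * B) = reduce_mat p (A * B)"
    "reduce_mat p (A * reduce_mat p B) = reduce_mat p (A * B)"
    using A B by (auto intro!: eq_matI simp: reduce_mat_def)
qed

lemma monoid_residue_mat_monoid:
  assumes "p > 1"
  shows "monoid (residue_mat_monoid n p)"
proof -
  let ?M = "residue_mat_monoid n p"
  have m: "x \<otimes>\<^bsub>?M\<^esub> y = reduce_mat p (x * y)" "\<one>\<^bsub>?M\<^esub> = 1\<^sub>m n" for x y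
    by (simp_all add: residue_mat_monoid_def)
  have c: "x \<in> carrier_mat n n" if "x \<in> carrier ?M" for x
    using that by (simp add: carrier_residue_mat_monoid)
  show ?thesis
  proof (rule monoidI; unfold m)
    show "1\<^sub>m n \<in> carrier ?M" using assms by (auto simp: carrier_residue_mat_monoid)
    show "reduce_mat p (x * y) \<in> carrier ?M" if "x \<in> carrier ?M" "y \<in> carrier ?M" for x y
      using assms c[OF that(1)] c[OF that(2)] by (intro reduce_mat_in_monoid) auto
    show "reduce_mat p (reduce_mat p (x * y) * z) = reduce_mat p (x * reduce_mat p (y * z))"
      if "x \<in> carrier ?M" "y \<in> carrier ?M" "z \<in> carrier ?M" for x y z
      using c[OF that(1)] c[OF that(2)] c[OF that(3)]
      by (simp add: reduce_mat_mult_reduce[of _ n] assoc_mult_mat[of _ n n _ n _ n])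
    show "reduce_mat p (1\<^sub>m n * x) = x" "reduce_mat p (x * 1\<^sub>m n) = x" if "x \<in> carrier ?M" for x
      using c[OF that] reduce_mat_id[OF that] by simp_all
  qed
qed

definition reflection_mat :: "nat \<Rightarrow> (nat \<Rightarrow> nat \<Rightarrow> int) \<Rightarrow> nat \<Rightarrow> int mat" where
  "reflection_mat n N i = mat n n (\<lambda>(k, j). of_bool (k = j) - (if k = i then N i j else 0))"

lemma reflection_mat_carrier [simp]: "reflection_mat n N i \<in> carrier_mat n n"
  by (simp add: reflection_mat_def)

lemma reflection_mat_mult_entry:
  assumes "A \<in> carrier_mat n n" "k < n" "j < n"
  shows "(reflection_mat n N i * A) $$ (k, j) =
    A $$ (k, j) - (if k = i then \<Sum>l<n. N i l * A $$ (l, j) else 0)"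
proof -
  have "(reflection_mat n N i * A) $$ (k, j) =
      (\<Sum>l<n. of_bool (k = l) * A $$ (l, j) - (if k = i then N i l * A $$ (l, j) else 0))"
    unfolding mult_mat_entry[OF reflection_mat_carrier assms] using assms
    by (intro sum.cong refl) (simp add: reflection_mat_def algebra_simps)
  also have "\<dots> = (\<Sum>l<n. if k = l then A $$ (l, j) else 0)
      - (\<Sum>l<n. if k = i then N i l * A $$ (l, j) else 0)"
    unfolding sum_subtractf by (intro arg_cong2[where f = "(-)"] sum.cong) auto
  finally show ?thesis using assms by simp
qed

lemma reflection_mat_involution:
  assumes "i < n" "N i i = 2"
  shows "reflection_mat n N i * reflection_mat n N i = 1\<^sub>m n"
proof (rule eq_matI)
  fix k j assume "k < dim_row (1\<^sub>m n :: int mat)" "j < dim_col (1\<^sub>m n :: int mat)"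
  then have kj: "k < n" "j < n" by simp_all
  have "(\<Sum>l<n. N i l * reflection_mat n N i $$ (l, j)) =
      (\<Sum>l<n. (if l = j then N i l else 0) - (if l = i then N i l * N i j else 0))"
    using kj by (intro sum.cong refl) (simp add: reflection_mat_def algebra_simps)
  also have "\<dots> = N i j - 2 * N i j" using assms kj by (simp add: sum_subtractf)
  finally have "(\<Sum>l<n. N i l * reflection_mat n N i $$ (l, j)) = - N i j" by simp
  moreover have "reflection_mat n N i $$ (k, j) = of_bool (k = j) - (if k = i then N i j else 0)"
    using kj by (simp add: reflection_mat_def)
  ultimately show "(reflection_mat n N i * reflection_mat n N i) $$ (k, j) = 1\<^sub>m n $$ (k, j)"
    using kj by (simp only: reflection_mat_mult_entry[OF reflection_mat_carrier kj]) simp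
qed (simp_all add: reflection_mat_def)

text \<open>For a basic system the quotient is an integer, and \<open>floor\<close> only changes the type.\<close>

definition cartan_entry :: "('v::real_vector \<Rightarrow> 'v \<Rightarrow> real) \<Rightarrow> (nat \<Rightarrow> 'v) \<Rightarrow> nat \<Rightarrow> nat \<Rightarrow> int" where
  "cartan_entry B b i j = \<lfloor>2 * B (b i) (b j) / B (b i) (b i)\<rfloor>"

lemma reduced_reflection_eq:
  assumes "basic_system ps B b" "n = length ps + 1" "i < n"
  shows "reduced_reflection n p B b i = reduce_mat p (reflection_mat n (cartan_entry B b) i)"
proof -
  have bs: "inj_on b {..<n}" "independent (b ` {..<n})" "span (b ` {..<n}) = UNIV"
    "\<And>x y. B x y = B y x"
    "\<And>i j. i < n \<Longrightarrow> j < n \<Longrightarrow> 2 * B (b i) (b j) / B (b i) (b i) \<in> \<int>"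
    using assms(1,2) by (auto simp: basic_system_def Let_def)
  have "map_mat floor (matrix_in_basis n b (refl_in B (b i))) = reflection_mat n (cartan_entry B b) i"
  proof (rule eq_matI)
    fix k j assume "k < dim_row (reflection_mat n (cartan_entry B b) i)"
      "j < dim_col (reflection_mat n (cartan_entry B b) i)"
    then have kj: "k < n" "j < n" by (simp_all add: reflection_mat_def)
    have eq: "b k = b l \<longleftrightarrow> k = l" if "l < n" for l
      using inj_on_eq_iff[OF bs(1)] kj(1) that by simp
    have "representation (b ` {..<n}) (refl_in B (b i) (b j)) (b k) =
        of_bool (k = j) - (if k = i then 2 * B (b j) (b i) / B (b i) (b i) else 0)"
      unfolding refl_in_def using bs(2,3) kj assms(3) eq[OF kj(2)] eq[OF assms(3)]
      by (simp add: representation_diff representation_scale representation_basis)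
    also have "2 * B (b j) (b i) / B (b i) (b i) = of_int (cartan_entry B b i j)"
      using bs(5)[OF assms(3) kj(2)] bs(4)[of "b j" "b i"] by (auto simp: cartan_entry_def elim: Ints_cases)
    finally have "\<lfloor>representation (b ` {..<n}) (refl_in B (b i) (b j)) (b k)\<rfloor> =
        of_bool (k = j) - (if k = i then cartan_entry B b i j else 0)"
      by simp
    then show "map_mat floor (matrix_in_basis n b (refl_in B (b i))) $$ (k, j) =
        reflection_mat n (cartan_entry B b) i $$ (k, j)"
      using kj by (simp add: matrix_in_basis_def reflection_mat_def)
  qed (simp_all add: matrix_in_basis_def reflection_mat_def)
  then show ?thesis by (simp add: reduced_reflection_def)
qed

lemma cartan_entry_diag:
  "basic_system ps B b \<Longrightarrow> i < length ps + 1 \<Longrightarrow> cartan_entry B b i i = 2"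
  by (auto simp: basic_system_def Let_def cartan_entry_def less_imp_neq[symmetric] dest: spec)

lemma mod_reflection_group_reduced_group:
  assumes bs: "basic_system ps B b" and n: "n = length ps + 1" and p: "p > 1"
  shows "mod_reflection_group (reduced_group n p B b) n (int p) (cartan_entry B b)
    (reduced_reflection n p B b) (\<lambda>g i j. g $$ (i, j))"
proof -
  let ?M = "residue_mat_monoid n p" and ?N = "cartan_entry B b"
  let ?r = "reduced_reflection n p B b" and ?G = "reduced_group n p B b"
  interpret M: monoid ?M using monoid_residue_mat_monoid[OF p] .
  have mult: "x \<otimes>\<^bsub>?G\<^esub> y = reduce_mat p (x * y)" "\<one>\<^bsub>?G\<^esub> = 1\<^sub>m n" for x y
    by (simp_all add: reduced_group_def GL_mod_def units_of_def residue_mat_monoid_def)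
  have r: "?r i = reduce_mat p (reflection_mat n ?N i)" if "i < n" for i
    by (rule reduced_reflection_eq[OF bs n that])
  have rr: "reduce_mat p (?r i * ?r i) = 1\<^sub>m n" if "i < n" for i
    using that cartan_entry_diag[OF bs] n r[OF that] p
    by (simp add: reduce_mat_mult_reduce[of _ n] reflection_mat_involution) 
      (rule reduce_mat_id[of _ n], use M.one_closed in \<open>simp add: residue_mat_monoid_def\<close>)
  have rM: "?r i \<in> carrier ?M" if "i < n" for i
    unfolding r[OF that] using p by (intro reduce_mat_in_monoid) auto
  have "?r i \<in> Units ?M" if "i < n" for i
    unfolding Units_def using rM[OF that] rr[OF that] by (auto simp: residue_mat_monoid_def)
  then have rGL: "?r ` {..<n} \<subseteq> carrier (GL_mod n p)"
    by (auto simp: GL_mod_def units_of_def)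
  have "group (GL_mod n p)" unfolding GL_mod_def by (rule M.units_group)
  then interpret G: group ?G
    unfolding reduced_group_def
    using group.generate_is_subgroup[OF _ rGL] subgroup.subgroup_is_group by blast
  have GM: "g \<in> carrier ?M" if "g \<in> carrier ?G" for g
  proof -
    have "g \<in> generate (GL_mod n p) (?r ` {..<n})" using that by (simp add: reduced_group_def)
    then have "g \<in> carrier (GL_mod n p)"
      by (rule group.generate_in_carrier[OF \<open>group (GL_mod n p)\<close> rGL])
    then show ?thesis by (simp add: GL_mod_def units_of_def M.Units_closed)
  qed
  have entry: "(?r i \<otimes>\<^bsub>?G\<^esub> g) $$ (l, j) =
      (g $$ (l, j) - (if l = i then \<Sum>k<n. ?N i k * g $$ (k, j) else 0)) mod int p"
    if "i < n" "l < n" "j < n" "g \<in> carrier ?G" for i l j g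
  proof -
    have g: "g \<in> carrier_mat n n" using GM[OF that(4)] by (simp add: carrier_residue_mat_monoid)
    then have "?r i \<otimes>\<^bsub>?G\<^esub> g = reduce_mat p (reflection_mat n ?N i * g)"
      unfolding mult r[OF that(1)] by (simp add: reduce_mat_mult_reduce[of _ n])
    moreover have "reflection_mat n ?N i * g \<in> carrier_mat n n"
      using g by (intro mult_carrier_mat) auto
    ultimately show ?thesis
      using that g by (simp only: reduce_mat_def carrier_matD index_map_mat reflection_mat_mult_entry)
  qed
  show ?thesis
  proof unfold_locales
    fix i assume "i < n"
    then show "?r i \<in> carrier ?G" by (simp add: reduced_group_def generate.incl)
    show "?r i \<otimes>\<^bsub>?G\<^esub> ?r i = \<one>\<^bsub>?G\<^esub>" unfolding mult by (rule rr[OF \<open>i < n\<close>])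
  next
    fix g h assume gh: "g \<in> carrier ?G" "h \<in> carrier ?G"
      "\<And>i j. i < n \<Longrightarrow> j < n \<Longrightarrow> [g $$ (i, j) = h $$ (i, j)] (mod int p)"
    show "g = h"
    proof (rule eq_matI)
      fix i j assume "i < dim_row h" "j < dim_col h"
      then have "i < n" "j < n" using GM[OF gh(2)] by (auto simp: carrier_residue_mat_monoid)
      then show "g $$ (i, j) = h $$ (i, j)"
        using gh(3) GM[OF gh(1)] GM[OF gh(2)] by (simp add: carrier_residue_mat_monoid cong_def)
    qed (use GM[OF gh(1)] GM[OF gh(2)] in \<open>auto simp: carrier_residue_mat_monoid\<close>)
  qed (simp_all add: entry mult(2) cong_def)
qed

theorem corollary3p2:
  fixes k m :: enat and p :: nat
    and B :: "'v::real_vector \<Rightarrow> 'v \<Rightarrow> real" and b :: "nat \<Rightarrow> 'v"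
  assumes "crystallographic_marks [k, \<infinity>, m]"
    and "basic_system [k, \<infinity>, m] B b"
    and "prime p" and "p \<ge> 3"
  shows "is_C_group (reduced_group 4 p B b) 4 (reduced_reflection 4 p B b)"
proof -
  have "p > 1" using assms(4) by simp
  interpret mod_reflection_group "reduced_group 4 p B b" 4 "int p" "cartan_entry B b"
    "reduced_reflection 4 p B b" "\<lambda>g i j. g $$ (i, j)"
    by (rule mod_reflection_group_reduced_group[OF assms(2) _ \<open>p > 1\<close>]) simp
  have bs: "\<And>x y. B x y = B y x" "B (b 1) (b 1) > 0" "B (b 2) (b 2) > 0"
    "B (b 1) (b 2) = - sqrt (B (b 1) (b 1) * B (b 2) (b 2))"
    "\<And>i j. i < 4 \<Longrightarrow> j < 4 \<Longrightarrow> i + 2 \<le> j \<Longrightarrow> B (b i) (b j) = 0"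
    "\<And>i j. i < 4 \<Longrightarrow> j < 4 \<Longrightarrow> 2 * B (b i) (b j) / B (b i) (b i) \<in> \<int>"
  proof -
    have len: "length [k, \<infinity>, m] + 1 = 4" by simp
    have *: "\<forall>x y. B x y = B y x" "\<forall>i<4. B (b i) (b i) > 0"
      "\<forall>i. i + 1 < 4 \<longrightarrow> B (b i) (b (i + 1)) =
        - cos_mark ([k, \<infinity>, m] ! i) * sqrt (B (b i) (b i) * B (b (i + 1)) (b (i + 1)))"
      "\<forall>i<4. \<forall>j<4. i + 2 \<le> j \<longrightarrow> B (b i) (b j) = 0"
      "\<forall>i<4. \<forall>j<4. 2 * B (b i) (b j) / B (b i) (b i) \<in> \<int>"
      using assms(2) unfolding basic_system_def Let_def len by - (elim conjE, assumption)+
    show "B x y = B y x" for x y using *(1) by simp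
    show "B (b 1) (b 1) > 0" "B (b 2) (b 2) > 0" using *(2) by simp_all
    show "B (b 1) (b 2) = - sqrt (B (b 1) (b 1) * B (b 2) (b 2))"
      using *(3)[rule_format, of 1] by (simp add: one_add_one)
    show "B (b i) (b j) = 0" if "i < 4" "j < 4" "i + 2 \<le> j" for i j
      using *(4) that by simp
    show "2 * B (b i) (b j) / B (b i) (b i) \<in> \<int>" if "i < 4" "j < 4" for i j
      using *(5) that by simp
  qed
  have N: "of_int (cartan_entry B b i j) = 2 * B (b i) (b j) / B (b i) (b i)"
    if "i < 4" "j < 4" for i j
    using bs(6)[OF that] by (auto simp: cartan_entry_def elim: Ints_cases)
  interpret infinite_middle_branch "reduced_group 4 p B b" "int p" "cartan_entry B b"
    "reduced_reflection 4 p B b" "\<lambda>g i j. g $$ (i, j)"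
  proof unfold_locales
    show "prime (int p)" "2 < int p" using assms(3,4) by simp_all
    show "cartan_entry B b i i = 2" if "i < 4" for i
      using cartan_entry_diag[OF assms(2)] that by simp
    show "cartan_entry B b i j = 0 \<and> cartan_entry B b j i = 0" if "i < 4" "j < 4" "i + 2 \<le> j" for i j
      using bs(5)[OF that] bs(1)[of "b i" "b j"] by (simp add: cartan_entry_def)
    have "real_of_int (cartan_entry B b 1 2 * cartan_entry B b 2 1) =
        4 * (B (b 1) (b 2))\<^sup>2 / (B (b 1) (b 1) * B (b 2) (b 2))"
      using N[of 1 2] N[of 2 1] bs(1)[of "b 1" "b 2"] by (simp add: power2_eq_square)
    also have "\<dots> = 4" using bs(2,3) unfolding bs(4) by simp
    finally show "cartan_entry B b 1 2 * cartan_entry B b 2 1 = 4" by linarith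
  qed
  show ?thesis
    unfolding is_C_group_def using intersection_property unfolding gen_def by blast
qed

end
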